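(* Let $(\lambda_n)_{n\ge 2}$ be a sequence of positive numbers with $\sum_{n=2}^\infty \lambda_n^{-1}<\infty$, let $X_2,X_3,\ldots$ be independent exponentially distributed random variables with $\mathbb{E}X_i=\lambda_i^{-1}$, and for $n\ge 1$ put $T_n=\sum_{i=n+1}^\infty X_i$ (the hitting time of state $n$ by the pure death process with death rates $(\lambda_n)$ started from infinity). For $n\ge1$ let $$A_n=\mathbb{E}T_n=\sum_{i=n+1}^\infty\lambda_i^{-1},\qquad B_n=\Big(\sum_{i=n+1}^\infty\lambda_i^{-2}\Big)^{1/2},\qquad C_n=\Big(\sum_{i=n+1}^\infty\lambda_i^{-3}\Big)^{1/3}.$$ (i) If $\lambda_n/\lambda_{n+1}\to\alpha$ as $n\to\infty$ for some $\alpha\in[0,1)$, then for each fixed $x\ge 0$, $$\mathbb{P}(A_n^{-1}T_n\le x)\to F_\alpha(x),\quad n\to\infty,$$ where $F_\alpha$ is the distribution function of a probability distribution on $[0,\infty)$ whose Laplace transform is $$\int_0^\infty e^{-ux}\,dF_\alpha(x)=\prod_{i\ge 0}\frac{1}{u\alpha^i(1-\alpha)+1},\quad u\ge 0.$$ (ii) If $\lambda_n^{-1}=o(A_n)$ as $n\to\infty$, then $A_n^{-1}T_n\to 1$ in probability as $n\to\infty$. (iii) If $\sum_{i=1}^\infty(\lambda_{i+1}A_i)^{-2}<\infty$, then $A_n^{-1}T_n\to 1$ almost surely as $n\to\infty$. (iv) If $\lambda_n^{-1}=o(A_n)$ and $C_n=o(B_n)$ as $n\to\infty$, then for all $x\in(-\infty,\infty)$,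 $$\mathbb{P}\Big(\frac{T_n-A_n}{B_n}\le x\Big)\to\Phi(x),\quad n\to\infty,$$ where $\Phi$ is the standard normal distribution function.
   Context: The pure death process $(Z(t),t\ge0)$ with death rates $(\lambda_n)_{n\ge2}$, absorbing state $1$ and $Z(0)=\infty$ jumps from $n$ to $n-1$ at rate $\lambda_n$; $X_n$ is its holding time in state $n$ and $T_n$ is the first time it hits state $n$. The convention $0^0=1$ is used when $\alpha=0$. *)

theory Defs
  imports "HOL-Probability.Probability" "HOL-Library.Landau_Symbols"
begin

(* For a death process started from infinity, the hitting time of state n is the sum of the
   holding times X_i in the states i > n.  The real-valued suminf is a junk constant where the
   series diverges; for the sequences considered here this is a null event. *)
definition hitting_time :: "(nat \<Rightarrow> 'a \<Rightarrow> real) \<Rightarrow> nat \<Rightarrow> 'a \<Rightarrow> real" where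
  "hitting_time X n \<omega> = (\<Sum>i. X (n + 1 + i) \<omega>)"

definition A_tail :: "(nat \<Rightarrow> real) \<Rightarrow> nat \<Rightarrow> real" where
  "A_tail l n = (\<Sum>i. 1 / l (n + 1 + i))"

definition B_tail :: "(nat \<Rightarrow> real) \<Rightarrow> nat \<Rightarrow> real" where
  "B_tail l n = sqrt (\<Sum>i. 1 / l (n + 1 + i) ^ 2)"

definition C_tail :: "(nat \<Rightarrow> real) \<Rightarrow> nat \<Rightarrow> real" where
  "C_tail l n = root 3 (\<Sum>i. 1 / l (n + 1 + i) ^ 3)"

definition converges_in_probability ::
    "'a measure \<Rightarrow> (nat \<Rightarrow> 'a \<Rightarrow> real) \<Rightarrow> real \<Rightarrow> bool" where
  "converges_in_probability M Y c \<longleftrightarrow>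
     (\<forall>e>0. (\<lambda>n. \<P>(\<omega> in M. \<bar>Y n \<omega> - c\<bar> > e)) \<longlonglongrightarrow> 0)"

(* The probability distributions on [0, infinity), as measures on the line, with the given
   Laplace transform.  Note that 0 ^ 0 = 1 here, so a = 0 gives the transform 1 / (u + 1). *)
definition is_limit_law :: "real \<Rightarrow> real measure \<Rightarrow> bool" where
  "is_limit_law a \<mu> \<longleftrightarrow>
     real_distribution \<mu> \<and> measure \<mu> {0..} = 1 \<and>
     (\<forall>u\<ge>0. (\<lambda>i. 1 / (u * a ^ i * (1 - a) + 1)) has_prod (LINT x:{0..}|\<mu>. exp (- u * x)))"

end

(* Up to a deterministic factor the holding times are independent standard exponentials, so T_n is a
   weighted sum of them, whose mean, variance, Laplace transform and characteristic function are limits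
   of those of the partial sums.  (i) The weights of T_n / A_n converge, under a geometric majorant, to
   a^i (1 - a); hence so do the Laplace transforms, and the limit law is the law of the corresponding
   weighted sum.  (ii) is Chebyshev's inequality, since o(1/l) means that the variance is o(A_n^2).
   (iii) is Etemadi's subsequence argument.  (iv) compares the characteristic function of the centred
   sum factor by factor with the Gaussian one, with an error of the order of the third moments. *)

theory Submission
  imports Defs
begin

section \<open>Weighted sums of independent exponential variables\<close>

text \<open>Two limits are nested, from partial sums to the series and then n to infinity. They are
  kept apart by stating every fact about a series for fixed weights, with a value or an error
  explicit in the weights: a series of logarithms for the Laplace transform, the sum of squares for
  the variance, the sum of cubes for the characteristic function. What remains for n to infinity
  concerns deterministic series only. In (i) the limit is known by its Laplace transform alone, yet
  convergence is claimed at every point x. This takes a continuity theorem for Laplace transforms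
  and a limit without atoms, which the density of the first summand supplies. In (iii) the danger is
  that \<open>A\<close> drops by a large factor in one step and so misses the geometric scale
  \<open>q ^ k\<close>. The summability condition forces its consecutive quotients to tend to 1; up
  to a constant, its series is also what bounds the sum of the rescaled variances once the order of
  summation is exchanged.\<close>

lemma AE_density_neq:
  fixes z :: real
  assumes [measurable]: "f \<in> borel_measurable borel"
  shows "AE x in density lborel f. x \<noteq> z"
  using AE_lborel_singleton[of z] by (subst AE_density) (auto elim!: eventually_mono)

lemma distributed_imp_AE_neq:
  fixes Z :: "'a \<Rightarrow> real"
  assumes "distributed M lborel Z f"
  shows "AE \<omega> in M. Z \<omega> \<noteq> z"
proof -
  have [measurable]: "Z \<in> borel_measurable M" "f \<in> borel_measurable borel"
    and d: "distr M lborel Z = density lborel f"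
    using assms by (auto simp: distributed_def)
  have "AE x in density lborel f. x \<noteq> z"
    by (rule AE_density_neq) simp
  then show ?thesis
    unfolding d[symmetric] by (subst (asm) AE_distr_iff) auto
qed

text \<open>The Gaussian half of the comparison in the central limit theorem. For small
  \<open>s\<close> the true error is of fourth order; the cube is chosen to match the third-moment
  error of the exponential factor, and for large \<open>s\<close> a quadratic bound already lies
  below the cube.\<close>

lemma exp_neg_half_square_bound:
  fixes s :: real
  shows "\<bar>exp (- (s\<^sup>2 / 2)) - (1 - s\<^sup>2 / 2)\<bar> \<le> \<bar>s\<bar> ^ 3"
proof -
  define y where "y = s\<^sup>2 / 2"
  have "y \<ge> 0" by (simp add: y_def)
  have lower: "1 - y \<le> exp (- y)"
    using exp_ge_add_one_self[of "- y"] by simp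
  have "exp (- y) - (1 - y) \<le> \<bar>s\<bar> ^ 3"
  proof (cases "\<bar>s\<bar> \<le> 1")
    case True
    have pos: "1 + y + y\<^sup>2 / 2 > 0"
      using \<open>y \<ge> 0\<close> by (simp add: add_pos_nonneg)
    have "exp (- y) \<le> 1 / (1 + y + y\<^sup>2 / 2)"
      using exp_lower_Taylor_quadratic[OF \<open>y \<ge> 0\<close>] pos
      by (simp add: exp_minus inverse_eq_divide frac_le)
    also have "\<dots> \<le> 1 - y + y\<^sup>2 / 2"
    proof -
      \<comment> \<open>Difference of squares:
        \<open>(1 + y\<^sup>2 / 2)\<^sup>2 - y\<^sup>2\<close>, which is at least 1.\<close>
      have "(1 - y + y\<^sup>2 / 2) * (1 + y + y\<^sup>2 / 2) = 1 + y ^ 4 / 4"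
        by (simp add: power2_eq_square power4_eq_xxxx field_simps)
      then show ?thesis
        using pos by (simp add: pos_divide_le_eq)
    qed
    finally have "exp (- y) - (1 - y) \<le> \<bar>s\<bar> ^ 4 / 8"
      by (simp add: y_def power_divide flip: power_mult)
    also have "\<dots> \<le> \<bar>s\<bar> ^ 4" by simp
    also have "\<dots> \<le> \<bar>s\<bar> ^ 3"
      using True by (intro power_decreasing) auto
    finally show ?thesis .
  next
    case False
    have "exp (- y) - (1 - y) \<le> y"
      using \<open>y \<ge> 0\<close> by simp
    also have "\<dots> \<le> \<bar>s\<bar> ^ 2"
      by (simp add: y_def)
    also have "\<dots> \<le> \<bar>s\<bar> ^ 3"
      using False by (intro power_increasing) auto
    finally show ?thesis .
  qed
  with lower show ?thesis
    by (simp add: y_def)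
qed

section \<open>Moments and Laplace transform of independent standard exponentials\<close>

locale iid_exponential = prob_space +
  fixes E :: "nat \<Rightarrow> 'a \<Rightarrow> real"
  assumes indep: "indep_vars (\<lambda>_. borel) E UNIV"
    and distributed_E: "distributed M lborel (E i) (exponential_density 1)"
begin

lemma E_measurable [measurable]: "E i \<in> borel_measurable M"
  using distributed_E[of i] by (simp add: distributed_def)

lemma E_nonneg: "AE \<omega> in M. E i \<omega> \<ge> 0"
  by (subst distributed_AE2[OF distributed_E]) (auto simp: exponential_density_def)

lemma E_nonneg_all: "AE \<omega> in M. \<forall>i. E i \<omega> \<ge> 0"
  using E_nonneg by (simp add: AE_all_countable)

lemma E_pow_integrable [simp]: "integrable M (\<lambda>\<omega>. E i \<omega> ^ k)"
  using erlang_ith_moment_integrable[OF _ distributed_E] by simp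

lemma E_integrable [simp]: "integrable M (E i)"
  using E_pow_integrable[of i 1] by simp

lemma E_moment: "expectation (\<lambda>\<omega>. E i \<omega> ^ k) = fact k"
  using erlang_ith_moment[OF _ distributed_E] by simp

lemma E_expectation [simp]: "expectation (E i) = 1"
  using E_moment[of i 1] by simp

lemma E_variance: "variance (E i) = 1"
  using exponential_distributed_variance[OF _ distributed_E] by simp

text \<open>Exponential tilting: the factor \<open>exp (- u * x)\<close> turns the density of rate 1
  into \<open>1 / (1 + u)\<close> times the density of rate \<open>1 + u\<close>, whose total mass
  is 1.\<close>

lemma E_laplace:
  assumes "u \<ge> 0"
  shows "expectation (\<lambda>\<omega>. exp (- u * E i \<omega>)) = 1 / (1 + u)"
proof -
  have "expectation (\<lambda>\<omega>. exp (- u * E i \<omega>)) = (\<integral>x. exponential_density 1 x * exp (- u * x) \<partial>lborel)"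
    by (rule distributed_integral[OF distributed_E, symmetric]) auto
  also have "\<dots> = (\<integral>x. exponential_density (1 + u) x * (1 / (1 + u)) \<partial>lborel)"
  proof (rule Bochner_Integration.integral_cong[OF refl])
    fix x
    have "exp (- x) * exp (- (u * x)) = exp (- (x * (1 + u)))"
      by (simp add: exp_add[symmetric] algebra_simps)
    then show "exponential_density 1 x * exp (- u * x) = exponential_density (1 + u) x * (1 / (1 + u))"
      using assms by (simp add: exponential_density_def)
  qed
  also have "\<dots> = (\<integral>x. exponential_density (1 + u) x \<partial>lborel) * (1 / (1 + u))"
    by simp
  also have "(\<integral>x. exponential_density (1 + u) x \<partial>lborel) = 1"
    using assms nn_integral_erlang_ith_moment[of "1 + u" 0 0]
    by (subst integral_eq_nn_integral) auto
  finally show ?thesis by simp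
qed

text \<open>Weights are kept apart from the variables so that the same facts serve mean holding
  times, for the hitting times, and geometric weights, for the limit law. Where the series diverges
  \<open>suminf\<close> yields a default value, so links to partial sums hold almost
  everywhere.\<close>

definition wsum :: "(nat \<Rightarrow> real) \<Rightarrow> 'a \<Rightarrow> real" where
  "wsum c \<omega> = (\<Sum>i. c i * E i \<omega>)"

lemma wsum_measurable [measurable]: "wsum c \<in> borel_measurable M"
  unfolding wsum_def[abs_def] by measurable

section \<open>Weighted sums with fixed nonnegative summable weights\<close>

context
  fixes c :: "nat \<Rightarrow> real"
  assumes c_nonneg: "\<And>i. c i \<ge> 0" and c_summable: "summable c"
begin

text \<open>Tonelli: the terms are nonnegative almost everywhere and their expectations are the
  weights, so the extended sum has the finite integral \<open>suminf c\<close>. Finiteness gives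
  convergence almost everywhere, and then the expectation.\<close>

lemma wsum_summable: "AE \<omega> in M. summable (\<lambda>i. c i * E i \<omega>)"
  and wsum_integrable: "integrable M (wsum c)"
  and wsum_expectation: "expectation (wsum c) = suminf c"
proof -
  have nn: "(\<integral>\<^sup>+\<omega>. ennreal (c i * E i \<omega>) \<partial>M) = c i" for i
  proof -
    have "(\<integral>\<^sup>+\<omega>. ennreal (c i * E i \<omega>) \<partial>M) = ennreal (expectation (\<lambda>\<omega>. c i * E i \<omega>))"
      using E_nonneg[of i] by (intro nn_integral_eq_integral) (auto simp: c_nonneg elim: eventually_mono)
    then show ?thesis by simp
  qed
  have total: "(\<integral>\<^sup>+\<omega>. (\<Sum>i. ennreal (c i * E i \<omega>)) \<partial>M) = ennreal (suminf c)"
    by (subst nn_integral_suminf) (auto simp: nn suminf_ennreal2 c_nonneg c_summable)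
  have "AE \<omega> in M. (\<Sum>i. ennreal (c i * E i \<omega>)) \<noteq> \<infinity>"
    by (intro nn_integral_noteq_infinite) (auto simp: total)
  with E_nonneg_all show summ: "AE \<omega> in M. summable (\<lambda>i. c i * E i \<omega>)"
  proof eventually_elim
    case (elim \<omega>)
    then show ?case by (intro summable_suminf_not_top) (auto simp: c_nonneg)
  qed
  have "has_bochner_integral M (wsum c) (suminf c)"
  proof (rule has_bochner_integral_nn_integral)
    show "AE \<omega> in M. 0 \<le> wsum c \<omega>"
      using E_nonneg_all summ by eventually_elim (auto simp: wsum_def c_nonneg intro!: suminf_nonneg)
    have "(\<integral>\<^sup>+\<omega>. ennreal (wsum c \<omega>) \<partial>M) = (\<integral>\<^sup>+\<omega>. (\<Sum>i. ennreal (c i * E i \<omega>)) \<partial>M)"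
      using E_nonneg_all summ
      by (intro nn_integral_cong_AE, eventually_elim) (auto simp: wsum_def suminf_ennreal2 c_nonneg)
    then show "(\<integral>\<^sup>+\<omega>. ennreal (wsum c \<omega>) \<partial>M) = ennreal (suminf c)"
      using total by simp
  qed (auto intro!: suminf_nonneg c_summable simp: c_nonneg)
  then show "integrable M (wsum c)" "expectation (wsum c) = suminf c"
    by (auto simp: has_bochner_integral_iff)
qed

lemma wsum_nonneg: "AE \<omega> in M. wsum c \<omega> \<ge> 0"
  using E_nonneg_all wsum_summable
  by eventually_elim (auto simp: wsum_def c_nonneg intro!: suminf_nonneg)

lemma psum_tendsto_wsum: "AE \<omega> in M. (\<lambda>n. \<Sum>i<n. c i * E i \<omega>) \<longlonglongrightarrow> wsum c \<omega>"
  using wsum_summable by eventually_elim (auto simp: wsum_def summable_LIMSEQ)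

lemma centered_psum_tendsto:
  "AE \<omega> in M. (\<lambda>n. \<Sum>i<n. c i * (E i \<omega> - 1)) \<longlonglongrightarrow> wsum c \<omega> - suminf c"
  using psum_tendsto_wsum
proof eventually_elim
  case (elim \<omega>)
  from tendsto_diff[OF this summable_LIMSEQ[OF c_summable]] show ?case
    by (simp add: sum_subtractf[symmetric] algebra_simps)
qed

lemma psum_laplace:
  assumes "u \<ge> 0"
  shows "expectation (\<lambda>\<omega>. exp (- u * (\<Sum>i<n. c i * E i \<omega>))) = (\<Prod>i<n. 1 / (u * c i + 1))"
proof -
  have *: "integrable M (\<lambda>\<omega>. exp (- (u * c i) * E i \<omega>))" for i
    using assms E_nonneg[of i] c_nonneg[of i]
    by (intro integrable_const_bound[of _ 1]) (auto elim!: eventually_mono)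
  have "expectation (\<lambda>\<omega>. exp (- u * (\<Sum>i<n. c i * E i \<omega>))) =
      expectation (\<lambda>\<omega>. \<Prod>i<n. exp (- (u * c i) * E i \<omega>))"
    by (simp add: sum_distrib_left exp_sum[symmetric] sum_negf mult.assoc)
  also have "\<dots> = (\<Prod>i<n. expectation (\<lambda>\<omega>. exp (- (u * c i) * E i \<omega>)))"
    using * by (intro indep_vars_lebesgue_integral indep_vars_compose2[OF indep_vars_subset[OF indep]]) auto
  also have "\<dots> = (\<Prod>i<n. 1 / (u * c i + 1))"
  proof (rule prod.cong[OF refl])
    fix i
    show "expectation (\<lambda>\<omega>. exp (- (u * c i) * E i \<omega>)) = 1 / (u * c i + 1)"
      using E_laplace[of "u * c i" i] assms c_nonneg[of i] by (simp add: add.commute)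
  qed
  finally show ?thesis .
qed

lemma wsum_laplace_tendsto:
  assumes "u \<ge> 0"
  shows "(\<lambda>n. \<Prod>i<n. 1 / (u * c i + 1)) \<longlonglongrightarrow> expectation (\<lambda>\<omega>. exp (- u * wsum c \<omega>))"
  unfolding psum_laplace[OF assms, symmetric]
proof (rule integral_dominated_convergence[where w = "\<lambda>_. 1"])
  show "AE \<omega> in M. (\<lambda>n. exp (- u * (\<Sum>i<n. c i * E i \<omega>))) \<longlonglongrightarrow> exp (- u * wsum c \<omega>)"
    using psum_tendsto_wsum by eventually_elim (intro tendsto_intros)
  show "AE \<omega> in M. norm (exp (- u * (\<Sum>i<n. c i * E i \<omega>))) \<le> 1" for n
    using E_nonneg_all by eventually_elim (auto simp: c_nonneg assms intro!: mult_nonneg_nonneg sum_nonneg)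
qed auto

text \<open>Logarithms replace the infinite product by a series, summable through
  \<open>ln (1 + y) \<le> y\<close>. In this form varying weights can be handled by dominated
  convergence of series.\<close>

lemma wsum_laplace:
  assumes "u \<ge> 0"
  shows "expectation (\<lambda>\<omega>. exp (- u * wsum c \<omega>)) = exp (- (\<Sum>i. ln (u * c i + 1)))"
proof -
  have pos: "0 \<le> u * c i" for i
    using assms c_nonneg by simp
  have "summable (\<lambda>i. ln (u * c i + 1))"
  proof (rule summable_comparison_test)
    show "summable (\<lambda>i. u * c i)"
      using c_summable by simp
    have "norm (ln (u * c n + 1)) \<le> u * c n" for n
      using ln_add_one_self_le_self[OF pos[of n]] pos[of n] by (simp add: add.commute)
    then show "\<exists>N. \<forall>n\<ge>N. norm (ln (u * c n + 1)) \<le> u * c n" by blast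
  qed
  then have "(\<lambda>n. exp (- (\<Sum>i<n. ln (u * c i + 1)))) \<longlonglongrightarrow> exp (- (\<Sum>i. ln (u * c i + 1)))"
    by (intro tendsto_intros summable_LIMSEQ)
  moreover have "exp (- (\<Sum>i<n. ln (u * c i + 1))) = (\<Prod>i<n. 1 / (u * c i + 1))" for n
    using pos by (auto simp: sum_negf[symmetric] exp_sum exp_minus inverse_eq_divide
        add_nonneg_pos intro!: prod.cong)
  ultimately show ?thesis
    using wsum_laplace_tendsto[OF assms] LIMSEQ_unique by fastforce
qed

text \<open>\<open>has_prod\<close> does not accept partial products of nonzero factors that tend to
  0; the exponential form shows that the limit is nonzero.\<close>

lemma wsum_laplace_has_prod:
  assumes "u \<ge> 0"
  shows "(\<lambda>i. 1 / (u * c i + 1)) has_prod expectation (\<lambda>\<omega>. exp (- u * wsum c \<omega>))"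
proof -
  have "(\<lambda>n. \<Prod>i\<le>n. 1 / (u * c i + 1)) \<longlonglongrightarrow> expectation (\<lambda>\<omega>. exp (- u * wsum c \<omega>))"
    using LIMSEQ_Suc[OF wsum_laplace_tendsto[OF assms]] by (simp only: lessThan_Suc_atMost)
  moreover have "expectation (\<lambda>\<omega>. exp (- u * wsum c \<omega>)) \<noteq> 0"
    unfolding wsum_laplace[OF assms] by simp
  ultimately show ?thesis
    by (simp add: has_prod_def raw_has_prod_def)
qed

lemma c_pow_summable: "summable (\<lambda>i. c i ^ Suc k)"
proof (rule summable_comparison_test_ev[OF _ c_summable])
  have "eventually (\<lambda>i. c i < 1) sequentially"
    using summable_LIMSEQ_zero[OF c_summable] by (rule order_tendstoD) simp
  then show "eventually (\<lambda>i. norm (c i ^ Suc k) \<le> c i) sequentially"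
  proof eventually_elim
    case (elim i)
    then have "c i * c i ^ k \<le> c i"
      using c_nonneg[of i] by (intro mult_left_le power_le_one) auto
    then show ?case
      using c_nonneg[of i] by simp
  qed
qed

text \<open>Induction on the number of terms: the new centred term is independent of the preceding
  sum and has mean zero, so the cross term vanishes. Integrability of the square is carried along
  for the additivity of the expectation.\<close>

lemma psum_centered_variance:
  "integrable M (\<lambda>\<omega>. (\<Sum>i<n. c i * (E i \<omega> - 1))\<^sup>2) \<and>
   expectation (\<lambda>\<omega>. (\<Sum>i<n. c i * (E i \<omega> - 1))\<^sup>2) = (\<Sum>i<n. (c i)\<^sup>2)"
proof (induction n)
  case 0
  then show ?case by simp
next
  case (Suc n)
  define Z where "Z i \<omega> = c i * (E i \<omega> - 1)" for i \<omega>
  define S where "S \<omega> = (\<Sum>i<n. Z i \<omega>)" for \<omega>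
  have IH: "integrable M (\<lambda>\<omega>. (S \<omega>)\<^sup>2)" "expectation (\<lambda>\<omega>. (S \<omega>)\<^sup>2) = (\<Sum>i<n. (c i)\<^sup>2)"
    using Suc by (auto simp: S_def Z_def)
  have int: "integrable M (Z i)" for i
    unfolding Z_def[abs_def] by simp
  have Z2: "integrable M (\<lambda>\<omega>. (Z n \<omega>)\<^sup>2)" "expectation (\<lambda>\<omega>. (Z n \<omega>)\<^sup>2) = (c n)\<^sup>2"
  proof -
    have "integrable M (\<lambda>\<omega>. (E n \<omega> - 1)\<^sup>2)" by (simp add: power2_diff)
    then show "integrable M (\<lambda>\<omega>. (Z n \<omega>)\<^sup>2)" by (simp add: Z_def power_mult_distrib)
    show "expectation (\<lambda>\<omega>. (Z n \<omega>)\<^sup>2) = (c n)\<^sup>2"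
      using E_variance[of n] by (simp add: Z_def power_mult_distrib)
  qed
  have ind: "indep_var borel (Z n) borel S"
    unfolding S_def[abs_def]
  proof (rule indep_vars_sum)
    show "indep_vars (\<lambda>_. borel) Z (insert n {..<n})"
      unfolding Z_def[abs_def] by (rule indep_vars_compose2[OF indep_vars_subset[OF indep]]) auto
  qed auto
  have intS: "integrable M S"
    unfolding S_def[abs_def] by (simp add: int)
  have cross: "integrable M (\<lambda>\<omega>. Z n \<omega> * S \<omega>)" "expectation (\<lambda>\<omega>. Z n \<omega> * S \<omega>) = 0"
  proof -
    show "integrable M (\<lambda>\<omega>. Z n \<omega> * S \<omega>)"
      by (rule indep_var_integrable[OF ind int intS])
    have "expectation (Z n) = 0" by (simp add: Z_def[abs_def] prob_space)
    then show "expectation (\<lambda>\<omega>. Z n \<omega> * S \<omega>) = 0"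
      using indep_var_lebesgue_integral[OF ind int intS] by simp
  qed
  have eq: "(\<Sum>i<Suc n. c i * (E i \<omega> - 1))\<^sup>2 = (S \<omega>)\<^sup>2 + 2 * (Z n \<omega> * S \<omega>) + (Z n \<omega>)\<^sup>2" for \<omega>
  proof -
    have "(\<Sum>i<Suc n. c i * (E i \<omega> - 1)) = S \<omega> + Z n \<omega>"
      by (simp add: S_def Z_def)
    then show ?thesis
      by (simp add: power2_sum)
  qed
  show ?case
    unfolding eq using IH Z2 cross by simp
qed

text \<open>Fatou's lemma along the centred partial sums. An upper bound is all that is used later,
  so convergence in mean square is not pursued.\<close>

lemma wsum_variance_le:
  "(\<integral>\<^sup>+\<omega>. ennreal ((wsum c \<omega> - suminf c)\<^sup>2) \<partial>M) \<le> ennreal (\<Sum>i. (c i)\<^sup>2)"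
proof -
  let ?S = "\<lambda>n \<omega>. \<Sum>i<n. c i * (E i \<omega> - 1)"
  from centered_psum_tendsto have "(\<integral>\<^sup>+\<omega>. ennreal ((wsum c \<omega> - suminf c)\<^sup>2) \<partial>M) =
      (\<integral>\<^sup>+\<omega>. liminf (\<lambda>n. ennreal ((?S n \<omega>)\<^sup>2)) \<partial>M)"
    by (intro nn_integral_cong_AE, eventually_elim)
       (intro lim_imp_Liminf[symmetric] tendsto_intros; simp)
  also have "\<dots> \<le> liminf (\<lambda>n. \<integral>\<^sup>+\<omega>. ennreal ((?S n \<omega>)\<^sup>2) \<partial>M)"
    by (rule nn_integral_liminf) measurable
  also have "\<dots> = liminf (\<lambda>n. ennreal (\<Sum>i<n. (c i)\<^sup>2))"
    using psum_centered_variance by (simp add: nn_integral_eq_integral)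
  also have "\<dots> = ennreal (\<Sum>i. (c i)\<^sup>2)"
    using c_pow_summable[of 1]
    by (intro lim_imp_Liminf tendsto_ennrealI summable_LIMSEQ) (auto simp: numeral_2_eq_2)
  finally show ?thesis .
qed

text \<open>Markov's inequality for the square, taken as a nonnegative integral because that is what
  \<open>wsum_variance_le\<close> bounds.\<close>

lemma wsum_chebyshev:
  assumes "e > 0"
  shows "\<P>(\<omega> in M. \<bar>wsum c \<omega> - suminf c\<bar> > e) \<le> (\<Sum>i. (c i)\<^sup>2) / e\<^sup>2"
proof -
  have s2: "summable (\<lambda>i. (c i)\<^sup>2)"
    using c_pow_summable[of 1] by (simp add: numeral_2_eq_2)
  have "emeasure M {\<omega> \<in> space M. \<bar>wsum c \<omega> - suminf c\<bar> > e} \<le>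
      emeasure M {\<omega> \<in> space M. 1 \<le> ennreal (1 / e\<^sup>2) * ennreal ((wsum c \<omega> - suminf c)\<^sup>2)}"
  proof (rule emeasure_mono, safe)
    fix \<omega> assume "\<bar>wsum c \<omega> - suminf c\<bar> > e"
    then have "e\<^sup>2 \<le> (wsum c \<omega> - suminf c)\<^sup>2"
      using assms by (simp add: abs_le_square_iff[symmetric])
    then show "1 \<le> ennreal (1 / e\<^sup>2) * ennreal ((wsum c \<omega> - suminf c)\<^sup>2)"
      using assms by (simp add: ennreal_mult[symmetric] field_simps)
  qed measurable
  also have "\<dots> \<le> ennreal (1 / e\<^sup>2) * (\<integral>\<^sup>+\<omega>. ennreal ((wsum c \<omega> - suminf c)\<^sup>2) * indicator (space M) \<omega> \<partial>M)"
    by (rule order_trans[OF _ nn_integral_Markov_inequality]) auto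
  also have "\<dots> \<le> ennreal (1 / e\<^sup>2) * ennreal (\<Sum>i. (c i)\<^sup>2)"
    using wsum_variance_le by (intro mult_left_mono) (simp_all cong: nn_integral_cong)
  also have "\<dots> = ennreal ((\<Sum>i. (c i)\<^sup>2) / e\<^sup>2)"
    using s2 by (simp add: ennreal_mult[symmetric] suminf_nonneg)
  finally show ?thesis
    using s2 by (simp add: emeasure_eq_measure suminf_nonneg)
qed

text \<open>Split off the first summand: if the rest \<open>R\<close> has the value y, the event
  forces \<open>E 0\<close> to equal the single number \<open>(x - y) / c 0\<close>, a null event as
  \<open>E 0\<close> has a density; Fubini concludes. Absence of atoms turns weak convergence into
  convergence of distribution functions at every point.\<close>

lemma wsum_no_atom:
  assumes "c 0 > 0"
  shows "\<P>(\<omega> in M. wsum c \<omega> = x) = 0"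
proof -
  define R where "R \<omega> = (\<Sum>i. c (Suc i) * E (Suc i) \<omega>)" for \<omega>
  have [measurable]: "R \<in> borel_measurable M"
    unfolding R_def[abs_def] by measurable
  have "indep_var borel ((\<lambda>f. f 0) \<circ> (\<lambda>\<omega>. restrict (\<lambda>i. E i \<omega>) {0}))
      borel ((\<lambda>f. \<Sum>i. c (Suc i) * f (Suc i)) \<circ> (\<lambda>\<omega>. restrict (\<lambda>i. E i \<omega>) {Suc 0..}))"
    by (rule indep_var_compose[OF indep_var_restrict[OF indep]]) auto
  also have "(\<lambda>f. f 0) \<circ> (\<lambda>\<omega>. restrict (\<lambda>i. E i \<omega>) {0}) = E 0"
    by auto
  also have "(\<lambda>f. \<Sum>i. c (Suc i) * f (Suc i)) \<circ> (\<lambda>\<omega>. restrict (\<lambda>i. E i \<omega>) {Suc 0..}) = R"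
    by (auto simp: R_def fun_eq_iff)
  finally have ind: "indep_var borel (E 0) borel R" .
  let ?A = "{p. c 0 * fst p + snd p = x} :: (real \<times> real) set"
  have A: "?A \<in> sets (borel \<Otimes>\<^sub>M borel)"
  proof -
    have "{p \<in> space (borel \<Otimes>\<^sub>M borel). c 0 * fst p + snd p = x} \<in> sets (borel \<Otimes>\<^sub>M borel)"
      by measurable
    then show ?thesis by (simp add: space_pair_measure)
  qed
  interpret PR: prob_space "distr M borel R" by (rule prob_space_distr) simp
  interpret PE: prob_space "distr M borel (E 0)" by (rule prob_space_distr) simp
  interpret P: pair_sigma_finite "distr M borel (E 0)" "distr M borel R" ..
  have "AE \<omega> in M. \<omega> \<in> {\<omega> \<in> space M. wsum c \<omega> = x} \<longleftrightarrow> \<omega> \<in> {\<omega> \<in> space M. (E 0 \<omega>, R \<omega>) \<in> ?A}"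
    using wsum_summable
  proof eventually_elim
    case (elim \<omega>)
    from suminf_split_head[OF this] show ?case
      by (auto simp: wsum_def R_def)
  qed
  then have "emeasure M {\<omega> \<in> space M. wsum c \<omega> = x} = emeasure M {\<omega> \<in> space M. (E 0 \<omega>, R \<omega>) \<in> ?A}"
    by (rule emeasure_eq_AE) (use A in measurable)
  also have "\<dots> = emeasure (distr M (borel \<Otimes>\<^sub>M borel) (\<lambda>\<omega>. (E 0 \<omega>, R \<omega>))) ?A"
    using A by (subst emeasure_distr) (auto intro!: arg_cong[where f = "emeasure M"])
  also have "\<dots> = emeasure (distr M borel (E 0) \<Otimes>\<^sub>M distr M borel R) ?A"
    using ind by (simp add: indep_var_distribution_eq)
  also have "\<dots> = (\<integral>\<^sup>+y. emeasure (distr M borel (E 0)) ((\<lambda>z. (z, y)) -` ?A) \<partial>distr M borel R)"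
    by (rule P.emeasure_pair_measure_alt2) (use A in simp)
  also have "\<dots> = (\<integral>\<^sup>+y. 0 \<partial>distr M borel R)"
  proof (rule nn_integral_cong)
    fix y
    have "(\<lambda>z. (z, y)) -` ?A = {(x - y) / c 0}"
      using assms by (auto simp: field_simps)
    moreover have "emeasure (distr M borel (E 0)) {(x - y) / c 0} = 0"
      using distributed_imp_AE_neq[OF distributed_E, of 0 "(x - y) / c 0"]
      by (subst emeasure_distr) (auto simp: vimage_def Int_def conj_commute AE_iff_measurable[OF _ refl])
    ultimately show "emeasure (distr M borel (E 0)) ((\<lambda>z. (z, y)) -` ?A) = 0"
      by simp
  qed
  finally show ?thesis
    by (simp add: measure_def)
qed

lemma psum_centered_char:
  "char (distr M borel (\<lambda>\<omega>. \<Sum>i<n. c i * (E i \<omega> - 1))) t =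
    (\<Prod>i<n. char (distr M borel (\<lambda>\<omega>. c i * (E i \<omega> - 1))) t)"
  by (rule char_distr_sum, rule indep_vars_compose2[OF indep_vars_subset[OF indep]]) auto

text \<open>Second-order Taylor expansion with a third-moment remainder: mean 0 and variance
  \<open>(c i)\<^sup>2\<close> supply the quadratic part. Of the minimum in the remainder only the
  cubic term is kept.\<close>

lemma centered_char_approx:
  "cmod (char (distr M borel (\<lambda>\<omega>. c i * (E i \<omega> - 1))) t - complex_of_real (1 - t\<^sup>2 * (c i)\<^sup>2 / 2)) \<le> 3 * \<bar>t\<bar> ^ 3 * c i ^ 3"
proof -
  let ?Z = "\<lambda>\<omega>. c i * (E i \<omega> - 1)"
  have I2: "integrable M (\<lambda>\<omega>. (E i \<omega> - 1)\<^sup>2)" by (simp add: power2_diff)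
  have "integrable M (\<lambda>\<omega>. (E i \<omega>) ^ 3 - 3 * (E i \<omega>) ^ 2 + 3 * E i \<omega> - 1)" by simp
  then have "integrable M (\<lambda>\<omega>. (E i \<omega> - 1) ^ 3)"
    by (rule Bochner_Integration.integrable_cong[THEN iffD1, rotated 2])
       (auto simp: power3_eq_cube power2_eq_square algebra_simps)
  then have I3: "integrable M (\<lambda>\<omega>. \<bar>E i \<omega> - 1\<bar> ^ 3)"
    using integrable_abs by (fastforce simp: power_abs)
  have "variance ?Z = (c i)\<^sup>2"
    using E_variance[of i] by (simp add: prob_space power_mult_distrib)
  then have "cmod (char (distr M borel ?Z) t - complex_of_real (1 - t\<^sup>2 * (c i)\<^sup>2 / 2)) \<le>
      (t\<^sup>2 / 6) * expectation (\<lambda>\<omega>. min (6 * (?Z \<omega>)\<^sup>2) (\<bar>t\<bar> * \<bar>?Z \<omega>\<bar> ^ 3))"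
    using I2 by (intro char_approx3') (auto simp: prob_space power_mult_distrib)
  also have "expectation (\<lambda>\<omega>. min (6 * (?Z \<omega>)\<^sup>2) (\<bar>t\<bar> * \<bar>?Z \<omega>\<bar> ^ 3)) \<le>
      expectation (\<lambda>\<omega>. \<bar>t\<bar> * c i ^ 3 * (E i \<omega> ^ 3 + 3 * E i \<omega> ^ 2 + 3 * E i \<omega> + 1))"
  proof (rule integral_mono_AE)
    show "integrable M (\<lambda>\<omega>. min (6 * (?Z \<omega>)\<^sup>2) (\<bar>t\<bar> * \<bar>?Z \<omega>\<bar> ^ 3))"
      using I2 I3 by (intro integrable_min integrable_mult_right)
        (auto simp: power_mult_distrib abs_mult)
    show "AE \<omega> in M. min (6 * (?Z \<omega>)\<^sup>2) (\<bar>t\<bar> * \<bar>?Z \<omega>\<bar> ^ 3) \<le>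
        \<bar>t\<bar> * c i ^ 3 * (E i \<omega> ^ 3 + 3 * E i \<omega> ^ 2 + 3 * E i \<omega> + 1)"
      using E_nonneg[of i]
    proof eventually_elim
      case (elim \<omega>)
      have "\<bar>E i \<omega> - 1\<bar> ^ 3 \<le> (E i \<omega> + 1) ^ 3"
        using elim by (intro power_mono) auto
      also have "\<dots> = E i \<omega> ^ 3 + 3 * E i \<omega> ^ 2 + 3 * E i \<omega> + 1"
        by (simp add: power3_eq_cube power2_eq_square algebra_simps)
      finally have "\<bar>t\<bar> * c i ^ 3 * \<bar>E i \<omega> - 1\<bar> ^ 3 \<le>
          \<bar>t\<bar> * c i ^ 3 * (E i \<omega> ^ 3 + 3 * E i \<omega> ^ 2 + 3 * E i \<omega> + 1)"
        by (intro mult_left_mono) (auto simp: c_nonneg)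
      then show ?case
        using c_nonneg[of i] by (intro min.coboundedI2) (auto simp: abs_mult power_mult_distrib mult.assoc)
    qed
  qed simp
  \<comment> \<open>The moments are factorials, and 6 + 3 * 2 + 3 * 1 + 1 = 16. Division by 6 leaves
    8 / 3, rounded up to 3.\<close>
  also have "\<dots> = \<bar>t\<bar> * c i ^ 3 * 16"
    by (simp add: E_moment prob_space fact_numeral)
  also have "t\<^sup>2 / 6 * (\<bar>t\<bar> * c i ^ 3 * 16) \<le> 3 * \<bar>t\<bar> ^ 3 * c i ^ 3"
  proof -
    have "t\<^sup>2 / 6 * (\<bar>t\<bar> * c i ^ 3 * 16) = 8 / 3 * (\<bar>t\<bar> ^ 3 * c i ^ 3)"
      by (subst power2_abs[symmetric]) (simp add: power3_eq_cube power2_eq_square)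
    also have "\<dots> \<le> 3 * (\<bar>t\<bar> ^ 3 * c i ^ 3)"
      using c_nonneg[of i] by (intro mult_right_mono) auto
    finally show ?thesis by simp
  qed
  finally show ?thesis
    by (simp add: mult_left_mono)
qed

text \<open>Products of factors of modulus at most 1 differ by at most the sum of the differences of
  the factors. The constant 4 is 3 from the Taylor expansion plus 1 from
  \<open>exp_neg_half_square_bound\<close>. Dominated convergence carries the bound from the partial
  sums to the series.\<close>

lemma wsum_centered_char:
  "cmod (char (distr M borel (\<lambda>\<omega>. wsum c \<omega> - suminf c)) t - complex_of_real (exp (- (t\<^sup>2 * (\<Sum>i. (c i)\<^sup>2) / 2))))
    \<le> 4 * \<bar>t\<bar> ^ 3 * (\<Sum>i. c i ^ 3)"
proof -
  let ?K = "4 * \<bar>t\<bar> ^ 3"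
  let ?S = "\<lambda>n \<omega>. \<Sum>i<n. c i * (E i \<omega> - 1)"
  have bound: "cmod (char (distr M borel (?S n)) t - complex_of_real (exp (- (t\<^sup>2 * (\<Sum>i<n. (c i)\<^sup>2) / 2))))
      \<le> ?K * (\<Sum>i<n. c i ^ 3)" for n
  proof -
    let ?w = "\<lambda>i. exp (- (t\<^sup>2 * (c i)\<^sup>2 / 2)) :: real"
    let ?z = "\<lambda>i. char (distr M borel (\<lambda>\<omega>. c i * (E i \<omega> - 1))) t"
    have "exp (- (t\<^sup>2 * (\<Sum>i<n. (c i)\<^sup>2) / 2)) = (\<Prod>i<n. ?w i)"
      by (simp add: sum_distrib_left sum_divide_distrib sum_negf[symmetric] exp_sum)
    then have "cmod (char (distr M borel (?S n)) t - complex_of_real (exp (- (t\<^sup>2 * (\<Sum>i<n. (c i)\<^sup>2) / 2)))) =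
        cmod ((\<Prod>i<n. ?z i) - (\<Prod>i<n. complex_of_real (?w i)))"
      by (simp add: psum_centered_char)
    also have "\<dots> \<le> (\<Sum>i<n. cmod (?z i - ?w i))"
    proof (rule norm_prod_diff)
      fix i
      interpret D: real_distribution "distr M borel (\<lambda>\<omega>. c i * (E i \<omega> - 1))"
        by (rule real_distribution_distr) simp
      show "cmod (?z i) \<le> 1" by (rule D.cmod_char_le_1)
      show "cmod (complex_of_real (?w i)) \<le> 1" by simp
    qed
    also have "\<dots> \<le> (\<Sum>i<n. ?K * c i ^ 3)"
    proof (rule sum_mono)
      fix i
      have "\<bar>?w i - (1 - t\<^sup>2 * (c i)\<^sup>2 / 2)\<bar> \<le> \<bar>t\<bar> ^ 3 * c i ^ 3"
        using exp_neg_half_square_bound[of "t * c i"] c_nonneg[of i]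
        by (simp add: power_mult_distrib abs_mult)
      then have "cmod (complex_of_real (1 - t\<^sup>2 * (c i)\<^sup>2 / 2) - complex_of_real (?w i)) \<le> \<bar>t\<bar> ^ 3 * c i ^ 3"
        by (simp only: of_real_diff[symmetric] norm_of_real abs_minus_commute)
      with centered_char_approx[of i t]
      have "cmod (?z i - complex_of_real (?w i)) \<le> 3 * \<bar>t\<bar> ^ 3 * c i ^ 3 + \<bar>t\<bar> ^ 3 * c i ^ 3"
        by (rule norm_diff_triangle_le)
      then show "cmod (?z i - ?w i) \<le> ?K * c i ^ 3"
        by (simp add: algebra_simps)
    qed
    finally show ?thesis by (simp add: sum_distrib_left)
  qed
  from centered_psum_tendsto have "AE \<omega> in M. (\<lambda>n. iexp (t * ?S n \<omega>)) \<longlonglongrightarrow> iexp (t * (wsum c \<omega> - suminf c))"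
    by eventually_elim (intro tendsto_exp tendsto_mult_left tendsto_of_real)
  then have "(\<lambda>n. expectation (\<lambda>\<omega>. iexp (t * ?S n \<omega>))) \<longlonglongrightarrow> expectation (\<lambda>\<omega>. iexp (t * (wsum c \<omega> - suminf c)))"
    by (rule integral_dominated_convergence[where w = "\<lambda>_. 1", rotated 3]) auto
  then have "(\<lambda>n. char (distr M borel (?S n)) t) \<longlonglongrightarrow> char (distr M borel (\<lambda>\<omega>. wsum c \<omega> - suminf c)) t"
    by (simp add: char_def integral_distr)
  moreover have "(\<lambda>n. complex_of_real (exp (- (t\<^sup>2 * (\<Sum>i<n. (c i)\<^sup>2) / 2))))
      \<longlonglongrightarrow> complex_of_real (exp (- (t\<^sup>2 * (\<Sum>i. (c i)\<^sup>2) / 2)))"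
    using c_pow_summable[of 1] by (intro tendsto_intros summable_LIMSEQ) (simp_all add: numeral_2_eq_2)
  moreover have "(\<lambda>n. ?K * (\<Sum>i<n. c i ^ 3)) \<longlonglongrightarrow> ?K * (\<Sum>i. c i ^ 3)"
    using c_pow_summable[of 2] by (intro tendsto_intros summable_LIMSEQ) (simp_all add: numeral_3_eq_3)
  ultimately show ?thesis
    by (intro LIMSEQ_le[OF tendsto_norm[OF tendsto_diff]]) (use bound in auto)
qed

end

end

section \<open>Weak convergence from Laplace transforms\<close>

text \<open>Tannery's theorem with a majorant that is uniform in the summation index but holds only
  for large n, which is where the geometric majorants become available.\<close>

lemma tendsto_suminf_dominated:
  fixes a :: "nat \<Rightarrow> nat \<Rightarrow> real"
  assumes "\<And>k. (\<lambda>n. a k n) \<longlonglongrightarrow> b k"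
    and "eventually (\<lambda>n. \<forall>k. \<bar>a k n\<bar> \<le> g k) sequentially"
    and "summable g"
  shows "(\<lambda>n. \<Sum>k. a k n) \<longlonglongrightarrow> suminf b"
proof -
  have "eventually (\<lambda>(k, n). norm (a k n) \<le> g k) (at_top \<times>\<^sub>F sequentially)"
    unfolding eventually_prod_filter
    by (rule exI[of _ "\<lambda>_. True"], rule exI, rule conjI[OF _ conjI[OF assms(2)]]) auto
  from tannerys_theorem[OF assms(1) this assms(3)] show ?thesis
    by simp
qed

text \<open>Under \<open>z = exp (- x)\<close> the Laplace transform at the natural numbers gives the moments of a law
  on the unit interval, where polynomials are uniformly dense.\<close>

lemma laplace_conv_imp_weak_conv:
  fixes Q :: "nat \<Rightarrow> real measure" and R :: "real measure"
  assumes Q: "\<And>n. real_distribution (Q n)" "\<And>n. AE x in Q n. x \<ge> 0"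
    and R: "real_distribution R" "AE x in R. x \<ge> 0"
    and conv: "\<And>k::nat. (\<lambda>n. \<integral>x. exp (- real k * x) \<partial>Q n) \<longlonglongrightarrow> (\<integral>x. exp (- real k * x) \<partial>R)"
  shows "weak_conv_m Q R"
proof (rule integral_cts_step_conv_imp_weak_conv[OF Q(1) R(1)])
  fix x y :: real assume "x < y"
  \<comment> \<open>The test function in the variable z = exp (- t). Cutting z off at
    \<open>exp (- y)\<close> avoids the logarithm at 0 and changes nothing, because
    \<open>cts_step x y\<close> vanishes from \<open>y\<close> on.\<close>
  define g where "g z = cts_step x y (- ln (max z (exp (- y))))" for z
  have cts: "continuous_on UNIV (cts_step x y)"
    using cts_step_uniformly_continuous[OF \<open>x < y\<close>] by (rule uniformly_continuous_imp_continuous)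
  have "continuous_on {0..1} g"
    unfolding g_def
  proof (rule continuous_on_compose2[OF cts])
    have "max z (exp (- y)) \<noteq> 0" for z
      by (metis exp_gt_zero less_max_iff_disj less_irrefl)
    then show "continuous_on {0..1} (\<lambda>z. - ln (max z (exp (- y))))"
      by (intro continuous_intros) auto
  qed simp
  have g_exp: "g (exp (- t)) = cts_step x y t" for t
  proof -
    have "max (exp (- t)) (exp (- y)) = exp (- min t y)"
      by (auto simp: max_def min_def)
    then show ?thesis
      using \<open>x < y\<close> by (auto simp: g_def cts_step_def min_def)
  qed
  show "(\<lambda>n. integral\<^sup>L (Q n) (cts_step x y)) \<longlonglongrightarrow> integral\<^sup>L R (cts_step x y)"
  proof (rule LIMSEQ_I)
    fix e :: real assume "e > 0"
    \<comment> \<open>Three errors of at most a quarter of \<open>e\<close> arise: approximation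
      under \<open>Q n\<close>, approximation under \<open>R\<close>, and the difference of the
      integrals of the polynomial.\<close>
    obtain p where p: "real_polynomial_function p" "\<And>z. z \<in> {0..1} \<Longrightarrow> \<bar>g z - p z\<bar> < e / 4"
      using Stone_Weierstrass_real_polynomial_function[OF compact_Icc \<open>continuous_on {0..1} g\<close>, of "e / 4"]
        \<open>e > 0\<close> by auto
    from p(1) obtain a m where pam: "p = (\<lambda>z. \<Sum>i\<le>m. a i * z ^ i)"
      by (auto simp: real_polynomial_function_iff_sum)
    \<comment> \<open>The approximation is uniform in z, so one polynomial serves all laws on the
      half-line.\<close>
    have near: "\<bar>integral\<^sup>L P (cts_step x y) - (\<Sum>i\<le>m. a i * (\<integral>t. exp (- real i * t) \<partial>P))\<bar> \<le> e / 4"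
      if P: "real_distribution P" "AE t in P. t \<ge> 0" for P
    proof -
      interpret P: real_distribution P by fact
      have exp_int: "integrable P (\<lambda>t. exp (- real i * t))" for i
        using P(2) by (intro P.integrable_const_bound[of _ 1]) (auto elim!: eventually_mono)
      have p_eq: "p (exp (- t)) = (\<Sum>i\<le>m. a i * exp (- real i * t))" for t
        by (simp add: pam exp_of_nat_mult[symmetric])
      have p_int: "integrable P (\<lambda>t. p (exp (- t)))"
        unfolding p_eq using exp_int by (intro Bochner_Integration.integrable_sum integrable_mult_right)
      have step_int: "integrable P (cts_step x y)"
        using \<open>x < y\<close> by (rule P.integrable_cts_step)
      have "(\<Sum>i\<le>m. a i * (\<integral>t. exp (- real i * t) \<partial>P)) = (\<integral>t. p (exp (- t)) \<partial>P)"
        unfolding p_eq using exp_int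
        by (subst Bochner_Integration.integral_sum) (auto intro: integrable_mult_right)
      then have "integral\<^sup>L P (cts_step x y) - (\<Sum>i\<le>m. a i * (\<integral>t. exp (- real i * t) \<partial>P)) =
          (\<integral>t. cts_step x y t - p (exp (- t)) \<partial>P)"
        using step_int p_int by simp
      also have "\<bar>\<dots>\<bar> \<le> (\<integral>t. \<bar>cts_step x y t - p (exp (- t))\<bar> \<partial>P)"
        by (rule integral_abs_bound)
      also have "\<dots> \<le> (\<integral>t. e / 4 \<partial>P)"
      proof (rule integral_mono_AE)
        show "AE t in P. \<bar>cts_step x y t - p (exp (- t))\<bar> \<le> e / 4"
          using P(2)
        proof eventually_elim
          case (elim t)
          then show ?case using p(2)[of "exp (- t)"] by (simp add: g_exp)
        qed
      qed (use step_int p_int in auto)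
      finally show ?thesis by (simp add: P.prob_space[unfolded P.space_eq_univ])
    qed
    have "(\<lambda>n. \<Sum>i\<le>m. a i * (\<integral>t. exp (- real i * t) \<partial>Q n)) \<longlonglongrightarrow> (\<Sum>i\<le>m. a i * (\<integral>t. exp (- real i * t) \<partial>R))"
      by (intro tendsto_intros conv)
    from LIMSEQ_D[OF this, of "e / 4"] \<open>e > 0\<close> obtain N where N: "\<And>n. n \<ge> N \<Longrightarrow>
      \<bar>(\<Sum>i\<le>m. a i * (\<integral>t. exp (- real i * t) \<partial>Q n)) - (\<Sum>i\<le>m. a i * (\<integral>t. exp (- real i * t) \<partial>R))\<bar> < e / 4"
      by auto
    show "\<exists>N. \<forall>n\<ge>N. norm (integral\<^sup>L (Q n) (cts_step x y) - integral\<^sup>L R (cts_step x y)) < e"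
    proof (intro exI[of _ N] allI impI)
      fix n assume "n \<ge> N"
      show "norm (integral\<^sup>L (Q n) (cts_step x y) - integral\<^sup>L R (cts_step x y)) < e"
        using N[OF \<open>n \<ge> N\<close>] near[OF Q(1,2), of n] near[OF R] \<open>e > 0\<close>
        unfolding real_norm_def by linarith
    qed
  qed
qed

lemma is_limit_lawD:
  assumes "is_limit_law a \<mu>"
  shows "real_distribution \<mu>" "AE x in \<mu>. x \<ge> 0"
    and "u \<ge> 0 \<Longrightarrow> (\<lambda>i. 1 / (u * a ^ i * (1 - a) + 1)) has_prod (\<integral>x. exp (- u * x) \<partial>\<mu>)"
proof -
  show \<mu>: "real_distribution \<mu>"
    using assms by (simp add: is_limit_law_def)
  interpret real_distribution \<mu> by fact
  have "measure \<mu> {0..} = 1"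
    using assms by (simp add: is_limit_law_def)
  then show nonneg: "AE x in \<mu>. x \<ge> 0"
    using prob_eq_1[of "{0..}"] by auto
  have "(LINT x:{0..}|\<mu>. exp (- u * x)) = (\<integral>x. exp (- u * x) \<partial>\<mu>)" for u
    unfolding set_lebesgue_integral_def
    by (rule integral_cong_AE) (use nonneg in \<open>auto elim!: eventually_mono\<close>)
  then show "u \<ge> 0 \<Longrightarrow> (\<lambda>i. 1 / (u * a ^ i * (1 - a) + 1)) has_prod (\<integral>x. exp (- u * x) \<partial>\<mu>)"
    using assms by (simp add: is_limit_law_def)
qed

lemma is_limit_lawI:
  assumes "real_distribution \<mu>" and nonneg: "AE x in \<mu>. x \<ge> 0"
    and prod: "\<And>u. u \<ge> 0 \<Longrightarrow> (\<lambda>i. 1 / (u * a ^ i * (1 - a) + 1)) has_prod (\<integral>x. exp (- u * x) \<partial>\<mu>)"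
  shows "is_limit_law a \<mu>"
proof -
  interpret real_distribution \<mu> by fact
  have "(LINT x:{0..}|\<mu>. exp (- u * x)) = (\<integral>x. exp (- u * x) \<partial>\<mu>)" for u
    unfolding set_lebesgue_integral_def
    by (rule integral_cong_AE) (use nonneg in \<open>auto elim!: eventually_mono\<close>)
  moreover have "measure \<mu> {0..} = 1"
    using prob_eq_1[of "{0..}"] nonneg by auto
  ultimately show ?thesis
    using assms by (simp add: is_limit_law_def)
qed

text \<open>Uniqueness from the continuity theorem: the constant sequence \<open>\<mu>\<close> has
  the transforms of \<open>\<nu>\<close>, hence converges weakly to \<open>\<nu>\<close>, and
  without atoms at every point. This carries results from a constructed law to any law with the same
  transform.\<close>

lemma limit_law_cdf_eq:
  assumes \<mu>: "is_limit_law a \<mu>" and \<nu>: "is_limit_law a \<nu>" and no_atom: "\<And>x. measure \<nu> {x} = 0"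
  shows "cdf \<mu> x = cdf \<nu> x"
proof -
  interpret real_distribution \<nu> using is_limit_lawD(1)[OF \<nu>] .
  have "weak_conv_m (\<lambda>_. \<mu>) \<nu>"
  proof (rule laplace_conv_imp_weak_conv)
    fix k :: nat
    have "(\<integral>x. exp (- real k * x) \<partial>\<mu>) = (\<integral>x. exp (- real k * x) \<partial>\<nu>)"
      using is_limit_lawD(3)[OF \<mu>, of "real k"] is_limit_lawD(3)[OF \<nu>, of "real k"]
      by (intro has_prod_unique2) auto
    then show "(\<lambda>_. \<integral>x. exp (- real k * x) \<partial>\<mu>) \<longlonglongrightarrow> (\<integral>x. exp (- real k * x) \<partial>\<nu>)"
      by simp
  qed (use \<mu> \<nu> is_limit_lawD in auto)
  then have "(\<lambda>_. cdf \<mu> x) \<longlonglongrightarrow> cdf \<nu> x"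
    using no_atom isCont_cdf by (auto simp: weak_conv_m_def weak_conv_def)
  then show ?thesis
    by (simp add: LIMSEQ_const_iff)
qed

section \<open>Death from infinity\<close>

text \<open>The singletons \<open>{f j}\<close> are pairwise disjoint by injectivity, so the
  families restricted to them are independent; each is then reduced to its one coordinate.\<close>

lemma (in prob_space) indep_vars_reindex:
  assumes "indep_vars N X A" and "inj_on f I" and "f ` I \<subseteq> A"
  shows "indep_vars (\<lambda>i. N (f i)) (\<lambda>i. X (f i)) I"
proof -
  have "indep_vars (\<lambda>j. PiM {f j} N) (\<lambda>j \<omega>. restrict (\<lambda>i. X i \<omega>) {f j}) I"
    using assms by (intro indep_vars_restrict) (auto simp: disjoint_family_on_def inj_on_def)
  from indep_vars_compose2[OF this, of "\<lambda>j g. g (f j)" "\<lambda>j. N (f j)"] show ?thesis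
    by simp
qed

locale death_from_infinity = prob_space +
  fixes l :: "nat \<Rightarrow> real" and X :: "nat \<Rightarrow> 'a \<Rightarrow> real"
  assumes l_pos: "n \<ge> 2 \<Longrightarrow> l n > 0"
    and l_summable: "summable (\<lambda>n. 1 / l (n + 2))"
    and X_indep: "indep_vars (\<lambda>_. borel) X {2..}"
    and X_distributed: "i \<ge> 2 \<Longrightarrow> distributed M lborel (X i) (exponential_density (l i))"
begin

section \<open>Hitting times as weighted sums of standard exponentials\<close>

abbreviation "T \<equiv> hitting_time X"
abbreviation "A \<equiv> A_tail l"

definition mean_time :: "nat \<Rightarrow> nat \<Rightarrow> real" where
  "mean_time n i = 1 / l (n + 1 + i)"

text \<open>Scaling by the rate makes the holding time standard exponential. With
  \<open>n \<ge> 1\<close> the state n + 1 + i is at least 2, where rates and laws are prescribed;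
  hence the condition \<open>n \<ge> 1\<close> in what follows.\<close>

definition unit_time :: "nat \<Rightarrow> nat \<Rightarrow> 'a \<Rightarrow> real" where
  "unit_time n i \<omega> = l (n + 1 + i) * X (n + 1 + i) \<omega>"

definition V :: "nat \<Rightarrow> real" where
  "V n = (\<Sum>i. (mean_time n i)\<^sup>2)"

lemma iid_unit_time: "n \<ge> 1 \<Longrightarrow> iid_exponential M (unit_time n)"
proof
  assume n: "n \<ge> 1"
  have "indep_vars (\<lambda>_. borel) (\<lambda>i. X (n + 1 + i)) UNIV"
    using n by (intro indep_vars_reindex[OF X_indep]) (auto simp: inj_on_def)
  then show "indep_vars (\<lambda>_. borel) (unit_time n) UNIV"
    unfolding unit_time_def[abs_def] by (rule indep_vars_compose2) simp
  fix i
  have "l (n + 1 + i) > 0"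
    using n by (intro l_pos) simp
  then show "distributed M lborel (unit_time n i) (exponential_density 1)"
    using erlang_distributed_mult_const[OF X_distributed[of "n + 1 + i"], of "l (n + 1 + i)"] n
    by (simp add: unit_time_def[abs_def])
qed

lemma mean_time_pos: "n \<ge> 1 \<Longrightarrow> mean_time n i > 0"
  by (simp add: mean_time_def l_pos)

lemma mean_time_nonneg: "n \<ge> 1 \<Longrightarrow> mean_time n i \<ge> 0"
  using mean_time_pos less_imp_le by blast

lemma mean_time_summable: "n \<ge> 1 \<Longrightarrow> summable (mean_time n)"
  using summable_ignore_initial_segment[OF l_summable, of "n - 1"]
  by (simp add: mean_time_def[abs_def] add_ac)

lemma mean_time_Suc: "mean_time n (Suc i) = mean_time (Suc n) i"
  by (simp add: mean_time_def)

lemma A_eq: "A n = suminf (mean_time n)"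
  by (simp add: A_tail_def mean_time_def[abs_def])

lemma T_eq:
  assumes "n \<ge> 1"
  shows "T n = iid_exponential.wsum (unit_time n) (mean_time n)"
proof -
  have "l (n + 1 + i) \<noteq> 0" for i
    using l_pos[of "n + 1 + i"] assms by simp
  then show ?thesis
    by (simp add: fun_eq_iff hitting_time_def iid_exponential.wsum_def[OF iid_unit_time[OF assms]]
        mean_time_def unit_time_def)
qed

lemma X_summable: "n \<ge> 1 \<Longrightarrow> AE \<omega> in M. summable (\<lambda>i. X (n + 1 + i) \<omega>)"
proof -
  assume n: "n \<ge> 1"
  have "l (n + 1 + i) \<noteq> 0" for i
    using l_pos[of "n + 1 + i"] n by simp
  then show ?thesis
    using iid_exponential.wsum_summable[OF iid_unit_time mean_time_nonneg mean_time_summable, OF n n n]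
    by (simp add: mean_time_def unit_time_def)
qed

lemma T_integrable: "n \<ge> 1 \<Longrightarrow> integrable M (T n)"
  and T_expectation: "n \<ge> 1 \<Longrightarrow> expectation (T n) = A n"
  by (simp_all add: T_eq A_eq iid_exponential.wsum_integrable iid_exponential.wsum_expectation
      iid_unit_time mean_time_nonneg mean_time_summable)

lemma T_measurable: "n \<ge> 1 \<Longrightarrow> T n \<in> borel_measurable M"
  using T_integrable by auto

lemma T_nonneg: "n \<ge> 1 \<Longrightarrow> AE \<omega> in M. T n \<omega> \<ge> 0"
  by (simp add: T_eq iid_exponential.wsum_nonneg iid_unit_time mean_time_nonneg mean_time_summable)

lemma A_pos: "n \<ge> 1 \<Longrightarrow> A n > 0"
  unfolding A_eq by (simp add: mean_time_pos mean_time_summable suminf_pos)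

lemma A_Suc: "n \<ge> 1 \<Longrightarrow> A n = 1 / l (n + 1) + A (Suc n)"
proof -
  assume "n \<ge> 1"
  then have "A n = mean_time n 0 + A (Suc n)"
    using suminf_split_head[OF mean_time_summable, of n] by (simp add: A_eq mean_time_Suc)
  then show ?thesis
    by (simp add: mean_time_def)
qed

lemma A_antimono: "m \<le> n \<Longrightarrow> 1 \<le> m \<Longrightarrow> A n \<le> A m"
proof (induction n rule: dec_induct)
  case (step k)
  then have "A k \<le> A m" "k \<ge> 1" "1 / l (k + 1) > 0"
    using l_pos[of "k + 1"] by auto
  with A_Suc[of k] show ?case by linarith
qed simp

lemma A_tendsto_0: "A \<longlonglongrightarrow> 0"
proof -
  have "(\<lambda>n. \<Sum>i. 1 / l (i + n + 2)) \<longlonglongrightarrow> 0"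
    using suminf_exist_split2[OF l_summable] by simp
  then have "(\<lambda>n. A (Suc n)) \<longlonglongrightarrow> 0"
    by (simp add: A_tail_def add_ac)
  then show ?thesis by (rule LIMSEQ_imp_Suc)
qed

lemma mean_time_pow_summable: "n \<ge> 1 \<Longrightarrow> summable (\<lambda>i. mean_time n i ^ Suc k)"
  using iid_exponential.c_pow_summable[OF iid_unit_time mean_time_nonneg mean_time_summable] .

lemma V_pos: "n \<ge> 1 \<Longrightarrow> V n > 0"
  using mean_time_pow_summable[of n 1] mean_time_pos[of n]
  unfolding V_def by (intro suminf_pos) (auto simp: numeral_2_eq_2)

lemma T_variance_le:
  "n \<ge> 1 \<Longrightarrow> (\<integral>\<^sup>+\<omega>. ennreal ((T n \<omega> - A n)\<^sup>2) \<partial>M) \<le> ennreal (V n)"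
  unfolding A_eq V_def
  by (simp add: T_eq iid_exponential.wsum_variance_le iid_unit_time mean_time_nonneg mean_time_summable)

lemma T_chebyshev: "n \<ge> 1 \<Longrightarrow> e > 0 \<Longrightarrow> \<P>(\<omega> in M. \<bar>T n \<omega> - A n\<bar> > e) \<le> V n / e\<^sup>2"
  unfolding A_eq V_def
  by (simp add: T_eq iid_exponential.wsum_chebyshev iid_unit_time mean_time_nonneg mean_time_summable)

lemma T_laplace:
  "n \<ge> 1 \<Longrightarrow> u \<ge> 0 \<Longrightarrow> expectation (\<lambda>\<omega>. exp (- u * T n \<omega>)) = exp (- (\<Sum>i. ln (u * mean_time n i + 1)))"
  unfolding T_eq
  by (rule iid_exponential.wsum_laplace[OF iid_unit_time mean_time_nonneg mean_time_summable])

lemma T_centered_char: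
  "n \<ge> 1 \<Longrightarrow> cmod (char (distr M borel (\<lambda>\<omega>. T n \<omega> - A n)) t - complex_of_real (exp (- (t\<^sup>2 * V n / 2))))
    \<le> 4 * \<bar>t\<bar> ^ 3 * (\<Sum>i. mean_time n i ^ 3)"
  unfolding A_eq V_def T_eq
  by (rule iid_exponential.wsum_centered_char[OF iid_unit_time mean_time_nonneg mean_time_summable])

section \<open>Convergence to the limit law when the ratios of the rates converge\<close>

lemma relative_mean_times:
  assumes \<alpha>: "0 \<le> \<alpha>" "\<alpha> < 1" and ratio: "(\<lambda>n. l n / l (n + 1)) \<longlonglongrightarrow> \<alpha>"
  obtains \<beta> where "0 \<le> \<beta>" "\<beta> < 1"
    "eventually (\<lambda>n. \<forall>i. 0 \<le> mean_time n i / A n \<and> mean_time n i / A n \<le> \<beta> ^ i) sequentially"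
    "\<And>i. (\<lambda>n. mean_time n i / A n) \<longlonglongrightarrow> \<alpha> ^ i * (1 - \<alpha>)"
proof -
  \<comment> \<open>The midpoint of \<alpha> and 1: the ratios are eventually below it, and its
    powers are still summable.\<close>
  define \<beta> where "\<beta> = (1 + \<alpha>) / 2"
  have \<beta>: "0 \<le> \<beta>" "\<beta> < 1" "\<alpha> < \<beta>"
    using \<alpha> by (auto simp: \<beta>_def)
  \<comment> \<open>Division by the first weight instead of \<open>A n\<close> makes
    \<open>r n i\<close> a product of consecutive ratios, each tending to \<alpha>. The factor
    \<open>A n\<close> is recovered from the sum of the \<open>r n i\<close>, which tends to
    \<open>1 / (1 - \<alpha>)\<close>.\<close>
  define r where "r n i = mean_time n i / mean_time n 0" for n i
  have mt0: "mean_time n 0 > 0" if "n \<ge> 1" for n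
    using mean_time_pos[OF that] .
  have r_Suc: "r n (Suc i) = r n i * (l (n + 1 + i) / l (n + 1 + i + 1))" if "n \<ge> 1" for n i
    using l_pos[of "n + 1"] l_pos[of "n + 1 + i"] l_pos[of "n + 1 + i + 1"] that
    by (simp add: r_def mean_time_def)
  have r_lim: "(\<lambda>n. r n i) \<longlonglongrightarrow> \<alpha> ^ i" for i
  proof (induction i)
    case 0
    have "eventually (\<lambda>n. r n 0 = 1) sequentially"
      using eventually_ge_at_top[of 1]
    proof eventually_elim
      case (elim n)
      then show ?case using mt0[of n] by (simp add: r_def)
    qed
    then show ?case by (simp add: tendsto_eventually)
  next
    case (Suc i)
    have "(\<lambda>n. r n i * (l (n + (1 + i)) / l (n + (1 + i) + 1))) \<longlonglongrightarrow> \<alpha> ^ i * \<alpha>"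
      by (intro tendsto_mult Suc.IH LIMSEQ_ignore_initial_segment[OF ratio])
    then have "(\<lambda>n. r n i * (l (n + 1 + i) / l (n + 1 + i + 1))) \<longlonglongrightarrow> \<alpha> ^ Suc i"
      by (simp add: add_ac mult.commute)
    moreover have "eventually (\<lambda>n. r n i * (l (n + 1 + i) / l (n + 1 + i + 1)) = r n (Suc i)) sequentially"
      using eventually_ge_at_top[of 1] by eventually_elim (simp add: r_Suc)
    ultimately show ?case by (rule Lim_transform_eventually)
  qed
  have "eventually (\<lambda>n. l n / l (n + 1) < \<beta>) sequentially"
    using ratio \<beta> by (intro order_tendstoD)
  then obtain N where N: "\<And>n. n \<ge> N \<Longrightarrow> l n / l (n + 1) < \<beta>"
    by (auto simp: eventually_sequentially)
  have r_nonneg: "0 \<le> r n i" if "n \<ge> 1" for n i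
    using that by (simp add: r_def mean_time_nonneg)
  have r_bound: "r n i \<le> \<beta> ^ i" if "n \<ge> max 1 N" for n i
  proof (induction i)
    case 0
    then show ?case using mt0[of n] that by (simp add: r_def)
  next
    case (Suc i)
    have "r n i * (l (n + 1 + i) / l (n + 1 + i + 1)) \<le> \<beta> ^ i * \<beta>"
      using Suc.IH N[of "n + 1 + i"] that l_pos[of "n + 1 + i"] l_pos[of "n + 1 + i + 1"] \<beta> r_nonneg[of n i]
      by (intro mult_mono) auto
    then show ?case using r_Suc[of n i] that by (simp add: mult.commute)
  qed
  have r_sum: "(\<Sum>i. r n i) = A n / mean_time n 0" if "n \<ge> 1" for n
    unfolding r_def A_eq by (rule suminf_divide[OF mean_time_summable[OF that]])
  have "(\<lambda>n. \<Sum>i. r n i) \<longlonglongrightarrow> (\<Sum>i. \<alpha> ^ i)"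
  proof (rule tendsto_suminf_dominated[OF r_lim])
    show "eventually (\<lambda>n. \<forall>i. \<bar>r n i\<bar> \<le> \<beta> ^ i) sequentially"
      using eventually_ge_at_top[of "max 1 N"]
      by eventually_elim (use r_bound r_nonneg in auto)
    show "summable (\<lambda>i. \<beta> ^ i)"
      using \<beta> by (simp add: summable_geometric)
  qed
  then have sum_lim: "(\<lambda>n. \<Sum>i. r n i) \<longlonglongrightarrow> 1 / (1 - \<alpha>)"
    using \<alpha> by (simp add: suminf_geometric)
  have quot: "mean_time n i / A n = r n i / (\<Sum>j. r n j)" if "n \<ge> 1" for n i
    using mt0[OF that] unfolding r_sum[OF that] by (simp add: r_def)
  \<comment> \<open>Dividing \<open>r n i\<close> by a sum that is at least 1 preserves the majorant
    \<open>\<beta> ^ i\<close>.\<close>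
  have sum_ge_1: "(\<Sum>i. r n i) \<ge> 1" if "n \<ge> 1" for n
  proof -
    have "mean_time n 0 \<le> A n"
      using A_Suc[OF that] A_pos[of "Suc n"] by (simp add: mean_time_def)
    then show ?thesis
      unfolding r_sum[OF that] using mt0[OF that] by simp
  qed
  show thesis
  proof
    show "eventually (\<lambda>n. \<forall>i. 0 \<le> mean_time n i / A n \<and> mean_time n i / A n \<le> \<beta> ^ i) sequentially"
      using eventually_ge_at_top[of "max 1 N"]
    proof eventually_elim
      case (elim n)
      then have n: "n \<ge> 1" by simp
      show ?case
      proof (intro allI conjI)
        fix i
        show "0 \<le> mean_time n i / A n"
          using mean_time_nonneg[OF n] A_pos[OF n] by (simp add: less_imp_le)
        have "r n i / (\<Sum>j. r n j) \<le> r n i / 1"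
          using sum_ge_1[OF n] r_nonneg[OF n] by (intro divide_left_mono) auto
        also have "\<dots> \<le> \<beta> ^ i" using r_bound[OF elim] by simp
        finally show "mean_time n i / A n \<le> \<beta> ^ i"
          unfolding quot[OF n] .
      qed
    qed
    fix i
    have "(\<lambda>n. r n i / (\<Sum>j. r n j)) \<longlonglongrightarrow> \<alpha> ^ i / (1 / (1 - \<alpha>))"
      using \<alpha> by (intro tendsto_divide r_lim sum_lim) auto
    then have "(\<lambda>n. r n i / (\<Sum>j. r n j)) \<longlonglongrightarrow> \<alpha> ^ i * (1 - \<alpha>)"
      by simp
    moreover have "eventually (\<lambda>n. r n i / (\<Sum>j. r n j) = mean_time n i / A n) sequentially"
      using eventually_ge_at_top[of 1] by eventually_elim (simp add: quot)
    ultimately show "(\<lambda>n. mean_time n i / A n) \<longlonglongrightarrow> \<alpha> ^ i * (1 - \<alpha>)"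
      by (rule Lim_transform_eventually)
  qed (use \<beta> in auto)
qed

text \<open>The witness is the weighted sum with weights
  \<open>\<alpha> ^ i * (1 - \<alpha>)\<close>, realised on the given probability space. Its first
  weight \<open>1 - \<alpha>\<close> is positive, also for \<alpha> = 0, which excludes
  atoms.\<close>

lemma limit_law_exists:
  assumes \<alpha>: "0 \<le> \<alpha>" "\<alpha> < 1"
  obtains \<nu> where "is_limit_law \<alpha> \<nu>" "\<And>x. measure \<nu> {x} = 0"
    "\<And>u. u \<ge> 0 \<Longrightarrow> (\<integral>x. exp (- u * x) \<partial>\<nu>) = exp (- (\<Sum>i. ln (u * (\<alpha> ^ i * (1 - \<alpha>)) + 1)))"
proof -
  interpret U: iid_exponential M "unit_time (Suc 0)"
    by (rule iid_unit_time) simp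
  define d where "d i = \<alpha> ^ i * (1 - \<alpha>)" for i
  have d: "\<And>i. d i \<ge> 0" "summable d" "d 0 > 0"
    using \<alpha> by (auto simp: d_def[abs_def] intro!: summable_mult2 summable_geometric)
  define \<nu> where "\<nu> = distr M borel (U.wsum d)"
  have lap: "(\<integral>x. exp (- u * x) \<partial>\<nu>) = expectation (\<lambda>\<omega>. exp (- u * U.wsum d \<omega>))" for u
    unfolding \<nu>_def by (subst integral_distr) auto
  show thesis
  proof
    show "is_limit_law \<alpha> \<nu>"
    proof (rule is_limit_lawI)
      show "real_distribution \<nu>"
        unfolding \<nu>_def by (rule real_distribution_distr) simp
      show "AE x in \<nu>. x \<ge> 0"
        unfolding \<nu>_def using U.wsum_nonneg[OF d(1,2)] by (subst AE_distr_iff) auto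
      fix u :: real assume "u \<ge> 0"
      from U.wsum_laplace_has_prod[OF d(1,2) this]
      show "(\<lambda>i. 1 / (u * \<alpha> ^ i * (1 - \<alpha>) + 1)) has_prod (\<integral>x. exp (- u * x) \<partial>\<nu>)"
        unfolding lap by (simp add: d_def mult.assoc)
    qed
    fix x
    show "measure \<nu> {x} = 0"
      using U.wsum_no_atom[OF d, of x] unfolding \<nu>_def
      by (subst measure_distr) (auto simp: vimage_def Int_def conj_commute)
  next
    fix u :: real assume "u \<ge> 0"
    then show "(\<integral>x. exp (- u * x) \<partial>\<nu>) = exp (- (\<Sum>i. ln (u * (\<alpha> ^ i * (1 - \<alpha>)) + 1)))"
      unfolding lap using U.wsum_laplace[OF d(1,2)] by (simp add: d_def)
  qed
qed

text \<open>The exponent of the Laplace transform of \<open>T n / A n\<close> is a series of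
  logarithms, eventually dominated by \<open>u * \<beta> ^ i\<close>, so it converges to that of the
  constructed law. The limit is obtained for this atomless law and then transferred to
  \<open>\<mu>\<close>.\<close>

theorem limit_law_convergence:
  assumes \<alpha>: "0 \<le> \<alpha>" "\<alpha> < 1" and ratio: "(\<lambda>n. l n / l (n + 1)) \<longlonglongrightarrow> \<alpha>"
    and \<mu>: "is_limit_law \<alpha> \<mu>"
  shows "(\<lambda>n. \<P>(\<omega> in M. T n \<omega> / A n \<le> x)) \<longlonglongrightarrow> cdf \<mu> x"
proof -
  obtain \<nu> where \<nu>: "is_limit_law \<alpha> \<nu>" "\<And>x. measure \<nu> {x} = 0"
    "\<And>u. u \<ge> 0 \<Longrightarrow> (\<integral>x. exp (- u * x) \<partial>\<nu>) = exp (- (\<Sum>i. ln (u * (\<alpha> ^ i * (1 - \<alpha>)) + 1)))"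
    using limit_law_exists[OF \<alpha>] by blast
  interpret \<nu>: real_distribution \<nu> using is_limit_lawD(1)[OF \<nu>(1)] .
  \<comment> \<open>Shifted by one: every member of the sequence must be a distribution, and
    \<open>T 0\<close> would involve \<open>X 1\<close>, about which nothing is assumed.\<close>
  define Q where "Q n = distr M borel (\<lambda>\<omega>. T (Suc n) \<omega> / A (Suc n))" for n
  have [measurable]: "T (Suc n) \<in> borel_measurable M" for n
    by (simp add: T_measurable)
  have lap: "(\<lambda>n. \<integral>x. exp (- u * x) \<partial>Q n) \<longlonglongrightarrow> (\<integral>x. exp (- u * x) \<partial>\<nu>)" if u: "u \<ge> 0" for u
  proof -
    obtain \<beta> where \<beta>: "0 \<le> \<beta>" "\<beta> < 1"
      and bound: "eventually (\<lambda>n. \<forall>i. 0 \<le> mean_time n i / A n \<and> mean_time n i / A n \<le> \<beta> ^ i) sequentially"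
      and lim: "\<And>i. (\<lambda>n. mean_time n i / A n) \<longlonglongrightarrow> \<alpha> ^ i * (1 - \<alpha>)"
      using relative_mean_times[OF \<alpha> ratio] by blast
    have "(\<lambda>n. \<Sum>i. ln (u * (mean_time n i / A n) + 1)) \<longlonglongrightarrow> (\<Sum>i. ln (u * (\<alpha> ^ i * (1 - \<alpha>)) + 1))"
    proof (rule tendsto_suminf_dominated)
      fix i
      have "0 \<le> u * (\<alpha> ^ i * (1 - \<alpha>))"
        using u \<alpha> by simp
      then show "(\<lambda>n. ln (u * (mean_time n i / A n) + 1)) \<longlonglongrightarrow> ln (u * (\<alpha> ^ i * (1 - \<alpha>)) + 1)"
        by (intro tendsto_intros lim) auto
    next
      show "eventually (\<lambda>n. \<forall>i. \<bar>ln (u * (mean_time n i / A n) + 1)\<bar> \<le> u * \<beta> ^ i) sequentially"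
        using bound
      proof eventually_elim
        case (elim n)
        show ?case
        proof
          fix i
          have le: "mean_time n i / A n \<le> \<beta> ^ i" and ge: "0 \<le> u * (mean_time n i / A n)"
            using elim u mult_nonneg_nonneg[of u "mean_time n i / A n"] by auto
          have "ln (u * (mean_time n i / A n) + 1) \<le> u * (mean_time n i / A n)"
            using ln_add_one_self_le_self[OF ge] by (simp add: add.commute)
          also have "\<dots> \<le> u * \<beta> ^ i"
            using le u by (rule mult_left_mono)
          finally show "\<bar>ln (u * (mean_time n i / A n) + 1)\<bar> \<le> u * \<beta> ^ i"
            using ge by simp
        qed
      qed
      show "summable (\<lambda>i. u * \<beta> ^ i)"
        using \<beta> by (intro summable_mult summable_geometric) simp
    qed
    then have "(\<lambda>n. exp (- (\<Sum>i. ln (u * (mean_time (Suc n) i / A (Suc n)) + 1)))) \<longlonglongrightarrow> (\<integral>x. exp (- u * x) \<partial>\<nu>)"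
      unfolding \<nu>(3)[OF u] by (intro tendsto_intros LIMSEQ_Suc)
    moreover have "(\<integral>x. exp (- u * x) \<partial>Q n) = exp (- (\<Sum>i. ln (u * (mean_time (Suc n) i / A (Suc n)) + 1)))" for n
      using T_laplace[of "Suc n" "u / A (Suc n)"] u A_pos[of "Suc n"]
      unfolding Q_def by (subst integral_distr) auto
    ultimately show ?thesis by simp
  qed
  have "weak_conv_m Q \<nu>"
  proof (rule laplace_conv_imp_weak_conv)
    show "real_distribution (Q n)" for n
      unfolding Q_def by (rule real_distribution_distr) simp
    show "AE x in Q n. x \<ge> 0" for n
      unfolding Q_def using T_nonneg[of "Suc n"] A_pos[of "Suc n"]
      by (subst AE_distr_iff) (auto elim!: eventually_mono)
  qed (use lap is_limit_lawD[OF \<nu>(1)] in auto)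
  then have "(\<lambda>n. cdf (Q n) x) \<longlonglongrightarrow> cdf \<nu> x"
    using \<nu>(2) \<nu>.isCont_cdf by (auto simp: weak_conv_m_def weak_conv_def)
  moreover have "cdf (Q n) x = \<P>(\<omega> in M. T (Suc n) \<omega> / A (Suc n) \<le> x)" for n
    unfolding Q_def cdf_def by (subst measure_distr) (auto simp: vimage_def Int_def conj_commute)
  ultimately show ?thesis
    unfolding limit_law_cdf_eq[OF \<mu> \<nu>(1,2)]
    by (intro LIMSEQ_imp_Suc[of "\<lambda>n. \<P>(\<omega> in M. T n \<omega> / A n \<le> x)"]) simp
qed

section \<open>Convergence in probability\<close>

theorem weak_law:
  assumes "(\<lambda>n. 1 / l n) \<in> o(A)"
  shows "converges_in_probability M (\<lambda>n \<omega>. T n \<omega> / A n) 1"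
  unfolding converges_in_probability_def
proof (intro allI impI)
  fix e :: real assume "e > 0"
  have V_le: "eventually (\<lambda>n. V n / (A n)\<^sup>2 \<le> d) sequentially" if "d > 0" for d
  proof -
    from landau_o.smallD[OF assms that] obtain N where
      N: "\<And>n. n \<ge> N \<Longrightarrow> \<bar>1 / l n\<bar> \<le> d * \<bar>A n\<bar>"
      by (auto simp: eventually_sequentially)
    show ?thesis
      using eventually_ge_at_top[of "max 1 N"]
    proof eventually_elim
      case (elim n)
      then have n: "n \<ge> 1" by simp
      \<comment> \<open>In each square one factor is bounded by \<open>d * A n\<close>, from the
        small-o condition at the state n + 1 + i and the monotonicity of \<open>A\<close>; the other
        factors sum up to \<open>A n\<close>.\<close>
      have "V n \<le> (\<Sum>i. d * A n * mean_time n i)"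
        unfolding V_def
      proof (rule suminf_le)
        fix i
        have "mean_time n i \<le> d * A (n + 1 + i)"
          using N[of "n + 1 + i"] A_pos[of "n + 1 + i"] l_pos[of "n + 1 + i"] elim
          by (simp add: mean_time_def)
        also have "\<dots> \<le> d * A n"
          using A_antimono[of n "n + 1 + i"] elim \<open>d > 0\<close> by simp
        finally show "(mean_time n i)\<^sup>2 \<le> d * A n * mean_time n i"
          using mean_time_nonneg[OF n, of i] unfolding power2_eq_square by (rule mult_right_mono)
      qed (use mean_time_pow_summable[OF n, of 1] mean_time_summable[OF n] in \<open>auto simp: numeral_2_eq_2 intro!: summable_mult\<close>)
      also have "\<dots> = d * A n * A n"
        using suminf_mult[OF mean_time_summable[OF n]] by (simp add: A_eq)
      finally show ?case
        using A_pos[OF n] by (simp add: divide_le_eq power2_eq_square mult.assoc)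
    qed
  qed
  have "(\<lambda>n. V n / (A n)\<^sup>2) \<longlonglongrightarrow> 0"
  proof (rule order_tendstoI)
    fix a :: real assume "a < 0"
    show "eventually (\<lambda>n. a < V n / (A n)\<^sup>2) sequentially"
      using eventually_ge_at_top[of 1]
    proof eventually_elim
      case (elim n)
      then have "0 \<le> V n / (A n)\<^sup>2" using V_pos[of n] by simp
      with \<open>a < 0\<close> show ?case by simp
    qed
  next
    fix a :: real assume "0 < a"
    show "eventually (\<lambda>n. V n / (A n)\<^sup>2 < a) sequentially"
      using V_le[OF half_gt_zero[OF \<open>0 < a\<close>]] by eventually_elim (use \<open>0 < a\<close> in linarith)
  qed
  then have "(\<lambda>n. V n / (A n)\<^sup>2 / e\<^sup>2) \<longlonglongrightarrow> 0"
    by (rule tendsto_divide_zero)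
  then show "(\<lambda>n. \<P>(\<omega> in M. \<bar>T n \<omega> / A n - 1\<bar> > e)) \<longlonglongrightarrow> 0"
  proof (rule tendsto_sandwich[OF _ _ tendsto_const, rotated 2])
    show "eventually (\<lambda>n. \<P>(\<omega> in M. \<bar>T n \<omega> / A n - 1\<bar> > e) \<le> V n / (A n)\<^sup>2 / e\<^sup>2) sequentially"
      using eventually_ge_at_top[of 1]
    proof eventually_elim
      case (elim n)
      have "\<bar>T n \<omega> / A n - 1\<bar> > e \<longleftrightarrow> \<bar>T n \<omega> - A n\<bar> > e * A n" for \<omega>
      proof -
        have "T n \<omega> / A n - 1 = (T n \<omega> - A n) / A n"
          using A_pos[OF elim] by (simp add: field_simps)
        then show ?thesis
          using A_pos[OF elim] by (simp add: pos_less_divide_eq)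
      qed
      then show ?case
        using T_chebyshev[OF elim, of "e * A n"] A_pos[OF elim] \<open>e > 0\<close>
        by (simp add: power_mult_distrib mult.commute)
    qed
  qed simp
qed

section \<open>Asymptotic normality through characteristic functions\<close>

theorem central_limit:
  assumes "C_tail l \<in> o(B_tail l)"
  shows "(\<lambda>n. \<P>(\<omega> in M. (T n \<omega> - A n) / B_tail l n \<le> x)) \<longlonglongrightarrow> cdf std_normal_distribution x"
proof -
  let ?B = "B_tail l" and ?C = "C_tail l"
  interpret N: real_distribution std_normal_distribution by (rule real_dist_normal_dist)
  have B: "?B n = sqrt (V n)" for n
    by (simp add: B_tail_def V_def mean_time_def power_one_over)
  have C: "?C n ^ 3 = (\<Sum>i. mean_time n i ^ 3)" if "n \<ge> 1" for n
  proof -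
    have "0 \<le> (\<Sum>i. mean_time n i ^ 3)"
      using mean_time_pow_summable[OF that, of 2] mean_time_nonneg[OF that]
      by (intro suminf_nonneg) (auto simp: numeral_3_eq_3)
    then show ?thesis
      by (simp add: C_tail_def mean_time_def power_one_over)
  qed
  define Q where "Q n = distr M borel (\<lambda>\<omega>. (T (Suc n) \<omega> - A (Suc n)) / ?B (Suc n))" for n
  have [measurable]: "T (Suc n) \<in> borel_measurable M" for n
    by (simp add: T_measurable)
  have "weak_conv_m Q std_normal_distribution"
  proof (rule levy_continuity)
    show "real_distribution (Q n)" for n
      unfolding Q_def by (rule real_distribution_distr) simp
    fix t :: real
    \<comment> \<open>At the argument \<open>t / ?B (Suc n)\<close> the Gaussian exponent becomes
      \<open>t\<^sup>2 / 2\<close>, and the error becomes a constant times the cube of the quotient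
      assumed to vanish.\<close>
    have bound: "norm (char (Q n) t - char std_normal_distribution t) \<le> 4 * \<bar>t\<bar> ^ 3 * \<bar>?C (Suc n) / ?B (Suc n)\<bar> ^ 3" for n
    proof -
      let ?n = "Suc n"
      have Bpos: "?B ?n > 0" and B2: "(?B ?n)\<^sup>2 = V ?n"
        using V_pos[of ?n] by (simp_all add: B)
      have "char (Q n) t = char (distr M borel (\<lambda>\<omega>. T ?n \<omega> - A ?n)) (t / ?B ?n)"
        unfolding Q_def char_def by (simp add: integral_distr)
      moreover have "(t / ?B ?n)\<^sup>2 * V ?n = t\<^sup>2"
        using Bpos by (simp add: power_divide flip: B2)
      ultimately have "norm (char (Q n) t - char std_normal_distribution t) \<le>
          4 * \<bar>t / ?B ?n\<bar> ^ 3 * (\<Sum>i. mean_time ?n i ^ 3)"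
        using T_centered_char[of ?n "t / ?B ?n"] by (simp add: char_std_normal_distribution)
      also have "\<dots> \<le> 4 * \<bar>t\<bar> ^ 3 * \<bar>?C ?n / ?B ?n\<bar> ^ 3"
        using Bpos unfolding C[of ?n, simplified, symmetric]
        by (simp add: abs_divide power_divide divide_right_mono mult_left_mono power_abs[symmetric])
      finally show ?thesis .
    qed
    have "(\<lambda>n. 4 * \<bar>t\<bar> ^ 3 * \<bar>?C (Suc n) / ?B (Suc n)\<bar> ^ 3) \<longlonglongrightarrow> 4 * \<bar>t\<bar> ^ 3 * \<bar>0\<bar> ^ 3"
      by (intro tendsto_intros LIMSEQ_Suc smalloD_tendsto assms)
    then have lim: "(\<lambda>n. 4 * \<bar>t\<bar> ^ 3 * \<bar>?C (Suc n) / ?B (Suc n)\<bar> ^ 3) \<longlonglongrightarrow> 0"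
      by simp
    have "(\<lambda>n. char (Q n) t - char std_normal_distribution t) \<longlonglongrightarrow> 0"
      by (rule Lim_null_comparison[OF always_eventually[OF allI[OF bound]] lim])
    then show "(\<lambda>n. char (Q n) t) \<longlonglongrightarrow> char std_normal_distribution t"
      by (simp add: LIM_zero_iff)
  qed (rule real_dist_normal_dist)
  moreover have "measure std_normal_distribution {x} = 0"
    using AE_density_neq[of std_normal_density x] by (subst N.prob_eq_0) auto
  ultimately have "(\<lambda>n. cdf (Q n) x) \<longlonglongrightarrow> cdf std_normal_distribution x"
    using N.isCont_cdf by (auto simp: weak_conv_m_def weak_conv_def)
  moreover have "cdf (Q n) x = \<P>(\<omega> in M. (T (Suc n) \<omega> - A (Suc n)) / ?B (Suc n) \<le> x)" for n
    unfolding Q_def cdf_def by (subst measure_distr) (auto simp: vimage_def Int_def conj_commute)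
  ultimately show ?thesis
    by (intro LIMSEQ_imp_Suc[of "\<lambda>n. \<P>(\<omega> in M. (T n \<omega> - A n) / ?B n \<le> x)"]) simp
qed

end

subsection \<open>The strong law\<close>

text \<open>The admissible \<open>k\<close> form an initial segment on which the terms grow
  geometrically. Their sum is thus comparable to the last one, which is at most
  \<open>(1 / a)\<^sup>2\<close>.\<close>

lemma sum_inverse_powers_le:
  fixes q a :: real
  assumes q: "0 < q" "q < 1" and "a > 0"
  shows "(\<Sum>k<K. if a \<le> q ^ k then (1 / q ^ k)\<^sup>2 else 0) \<le> (1 / a)\<^sup>2 / (1 - q\<^sup>2)"
proof (induction K)
  case 0
  then show ?case using q by (simp add: power_le_one)
next
  case (Suc K)
  have q2: "1 - q\<^sup>2 > 0"
    using q by (simp add: power_less_one_iff)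
  show ?case
  proof (cases "a \<le> q ^ K")
    case True
    \<comment> \<open>If \<open>K\<close> is admissible, so is every smaller index, and dropping the
      condition loses nothing.\<close>
    have "(\<Sum>k<Suc K. if a \<le> q ^ k then (1 / q ^ k)\<^sup>2 else 0) \<le> (\<Sum>k<Suc K. (1 / q ^ k)\<^sup>2)"
      by (intro sum_mono) auto
    also have "\<dots> \<le> (1 / q ^ K)\<^sup>2 / (1 - q\<^sup>2)"
    proof (induction K)
      case 0
      then show ?case using q2 by (simp add: le_divide_eq)
    next
      case (Suc K)
      have "(1 / q ^ K)\<^sup>2 = q\<^sup>2 * (1 / q ^ Suc K)\<^sup>2"
        using q by (simp add: power_divide power_mult_distrib)
      moreover have "q\<^sup>2 * x / (1 - q\<^sup>2) + x = x / (1 - q\<^sup>2)" for x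
        using q2 by (simp add: field_simps)
      ultimately have "(1 / q ^ K)\<^sup>2 / (1 - q\<^sup>2) + (1 / q ^ Suc K)\<^sup>2 = (1 / q ^ Suc K)\<^sup>2 / (1 - q\<^sup>2)"
        by simp
      with Suc show ?case by simp
    qed
    also have "\<dots> \<le> (1 / a)\<^sup>2 / (1 - q\<^sup>2)"
      using True \<open>a > 0\<close> q q2 by (intro divide_right_mono power_mono divide_left_mono) auto
    finally show ?thesis .
  next
    case False
    then show ?thesis using Suc by simp
  qed
qed

context death_from_infinity
begin

text \<open>Consecutive hitting times differ by one nonnegative holding time. This needs the series
  to converge, hence the null set, which is the same for all pairs of indices.\<close>

lemma T_antimono: "AE \<omega> in M. \<forall>m n. 1 \<le> m \<longrightarrow> m \<le> n \<longrightarrow> T n \<omega> \<le> T m \<omega>"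
proof -
  have "AE \<omega> in M. X (Suc (Suc n)) \<omega> \<ge> 0" for n
    using l_pos[of "Suc (Suc n)"]
    by (subst distributed_AE2[OF X_distributed]) (auto simp: exponential_density_def)
  then have "AE \<omega> in M. \<forall>n. X (Suc (Suc n)) \<omega> \<ge> 0"
    by (simp add: AE_all_countable)
  with X_summable[OF order_refl] show ?thesis
  proof eventually_elim
    case (elim \<omega>)
    have step_T: "T (Suc n) \<omega> \<le> T n \<omega>" if "n \<ge> 1" for n
    proof -
      have "summable (\<lambda>i. X (n + 1 + i) \<omega>)"
        using summable_ignore_initial_segment[OF elim(1), of "n - 1"] that by (simp add: add_ac)
      from suminf_split_head[OF this] have "T n \<omega> = X (Suc n) \<omega> + T (Suc n) \<omega>"
        by (simp add: hitting_time_def)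
      moreover have "X (Suc n) \<omega> \<ge> 0"
        using elim(2) that by (cases n) auto
      ultimately show ?thesis by simp
    qed
    have "T n \<omega> \<le> T m \<omega>" if "m \<le> n" "1 \<le> m" for m n
      using that
    proof (induction n rule: dec_induct)
      case (step k)
      then have "T k \<omega> \<le> T m \<omega>" "T (Suc k) \<omega> \<le> T k \<omega>"
        using step_T[of k] by auto
      then show ?case by simp
    qed simp
    then show ?case by blast
  qed
qed

text \<open>The summation index no longer depends on \<open>n\<close>, so the series for different
  levels can be added termwise.\<close>

lemma V_sums:
  assumes "n \<ge> 1"
  shows "(\<lambda>j. if n \<le> j + 1 then (1 / l (j + 2))\<^sup>2 else 0) sums V n"
proof -
  have "(\<lambda>j. (mean_time n j)\<^sup>2) sums V n"
    unfolding V_def using mean_time_pow_summable[OF assms, of 1]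
    by (intro summable_sums) (simp add: numeral_2_eq_2)
  \<comment> \<open>Counted from state 2, the state \<open>n + 1 + j\<close> has number
    \<open>j + (n - 1)\<close>.\<close>
  also have "(\<lambda>j. (mean_time n j)\<^sup>2) = (\<lambda>j. if n \<le> (j + (n - 1)) + 1 then (1 / l ((j + (n - 1)) + 2))\<^sup>2 else 0)"
    using assms by (auto simp: mean_time_def fun_eq_iff add_ac)
  finally have "(\<lambda>j. if n \<le> j + 1 then (1 / l (j + 2))\<^sup>2 else 0) sums
      (V n + (\<Sum>j<n - 1. if n \<le> j + 1 then (1 / l (j + 2))\<^sup>2 else 0))"
    by (subst (asm) sums_iff_shift)
  also have "(\<Sum>j<n - 1. if n \<le> j + 1 then (1 / l (j + 2))\<^sup>2 else 0) = 0"
    by (rule sum.neutral) auto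
  finally show ?thesis by simp
qed

text \<open>Etemadi's method: along the times at which \<open>A\<close> falls below the powers of \<open>q\<close> the variances
  are summable, and between two of these times both \<open>T\<close> and \<open>A\<close> are monotone.\<close>

context
  fixes q :: real
  assumes q_half: "1 / 2 \<le> q" and "q < 1"
    and summable_squares: "summable (\<lambda>i. 1 / (l (i + 2) * A (i + 1))\<^sup>2)"
begin

lemma q: "0 < q" "q < 1"
  using q_half \<open>q < 1\<close> by auto

text \<open>The clause \<open>n \<ge> 1\<close> avoids \<open>A 0\<close>, which contains the
  unrestricted rate \<open>l 1\<close>.\<close>

definition level :: "nat \<Rightarrow> nat" where
  "level k = (LEAST n. n \<ge> 1 \<and> A n \<le> q ^ k)"

lemma level: "level k \<ge> 1" "A (level k) \<le> q ^ k"
proof -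
  have "eventually (\<lambda>n. A n < q ^ k) sequentially"
    using A_tendsto_0 q by (intro order_tendstoD) auto
  then have "eventually (\<lambda>n. n \<ge> 1 \<and> A n \<le> q ^ k) sequentially"
    using eventually_ge_at_top[of 1] by eventually_elim auto
  then have "\<exists>n. n \<ge> 1 \<and> A n \<le> q ^ k"
    by (rule eventually_happens'[OF sequentially_bot])
  from LeastI_ex[OF this] show "level k \<ge> 1" "A (level k) \<le> q ^ k"
    by (auto simp: level_def)
qed

lemma level_le_iff: "n \<ge> 1 \<Longrightarrow> level k \<le> n \<longleftrightarrow> A n \<le> q ^ k"
proof
  assume "n \<ge> 1" "level k \<le> n"
  then show "A n \<le> q ^ k"
    using A_antimono[of "level k" n] level[of k] by simp
next
  assume "n \<ge> 1" "A n \<le> q ^ k"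
  then show "level k \<le> n"
    unfolding level_def by (intro Least_le) simp
qed

text \<open>No overshoot: summable terms tend to 0, so eventually
  \<open>1 / (l (i + 2) * A (i + 1)) < 1 - q\<close>, and one step shrinks \<open>A\<close> at most
  by the factor \<open>q\<close>. Just before the level \<open>A\<close> still exceeds
  \<open>q ^ k\<close>.\<close>

lemma A_level_ge: "eventually (\<lambda>k. q ^ Suc k \<le> A (level k)) sequentially"
proof -
  have "(\<lambda>i. 1 / (l (i + 2) * A (i + 1))\<^sup>2) \<longlonglongrightarrow> 0"
    using summable_squares by (rule summable_LIMSEQ_zero)
  then have "eventually (\<lambda>i. 1 / (l (i + 2) * A (i + 1))\<^sup>2 < (1 - q)\<^sup>2) sequentially"
    using q by (intro order_tendstoD) auto
  then obtain N where N: "\<And>i. i \<ge> N \<Longrightarrow> 1 / (l (i + 2) * A (i + 1))\<^sup>2 < (1 - q)\<^sup>2"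
    by (auto simp: eventually_sequentially)
  have A_ratio: "q * A (Suc i) \<le> A (Suc (Suc i))" if "i \<ge> N" for i
  proof -
    have pos: "A (Suc i) > 0" "l (i + 2) > 0"
      by (auto intro: A_pos l_pos)
    have "(1 / (l (i + 2) * A (i + 1)))\<^sup>2 < (1 - q)\<^sup>2"
      using N[OF that] by (simp add: power_one_over)
    then have "1 / (l (i + 2) * A (i + 1)) < 1 - q"
      by (rule power_less_imp_less_base) (use q in simp)
    then have "1 / l (i + 2) < (1 - q) * A (Suc i)"
      using pos by (simp add: field_simps)
    moreover have "A (Suc i) = 1 / l (i + 2) + A (Suc (Suc i))"
      using A_Suc[of "Suc i"] by simp
    moreover have "(1 - q) * A (Suc i) = A (Suc i) - q * A (Suc i)"
      by (simp add: algebra_simps)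
    ultimately show ?thesis by linarith
  qed
  have "(\<lambda>k. q ^ k) \<longlonglongrightarrow> 0"
    using q by (intro LIMSEQ_power_zero) simp
  then have "eventually (\<lambda>k. q ^ k < A (Suc N)) sequentially"
    using A_pos[of "Suc N"] by (intro order_tendstoD) auto
  then show ?thesis
  proof eventually_elim
    case (elim k)
    \<comment> \<open>The level lies beyond \<open>Suc N\<close>, so its predecessor
      \<open>Suc i\<close> is in the range where the step estimate applies.\<close>
    then have "\<not> level k \<le> Suc N"
      using level_le_iff[of "Suc N" k] by simp
    then have "level k = Suc (Suc (level k - 2))" "level k - 2 \<ge> N"
      by auto
    then obtain i where i: "level k = Suc (Suc i)" "i \<ge> N"
      by blast
    have "\<not> level k \<le> Suc i"
      using i by simp
    then have "q ^ k < A (Suc i)"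
      using level_le_iff[of "Suc i" k] by simp
    then have "q ^ Suc k \<le> q * A (Suc i)"
      using q by simp
    also have "\<dots> \<le> A (level k)"
      using A_ratio[OF i(2)] i(1) by simp
    finally show ?case .
  qed
qed

text \<open>Exchange of summation: the state j + 2 contributes exactly to the levels
  \<open>k\<close> with \<open>A (j + 1) \<le> q ^ k\<close>, and over these
  \<open>(1 / q ^ k)\<^sup>2\<close> sums to at most a constant times
  \<open>(1 / A (j + 1))\<^sup>2\<close>. The assumed series comes out. Finite sums over
  \<open>k\<close> avoid a double series.\<close>

lemma level_variance_summable: "summable (\<lambda>k. V (level k) * (1 / q ^ k)\<^sup>2)"
proof (rule summableI_nonneg_bounded)
  show "0 \<le> V (level k) * (1 / q ^ k)\<^sup>2" for k
    using V_pos[OF level(1), of k] by simp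
  fix K
  define W where "W k j = (if level k \<le> j + 1 then (1 / l (j + 2))\<^sup>2 else 0) * (1 / q ^ k)\<^sup>2" for k j
  have W: "W k sums (V (level k) * (1 / q ^ k)\<^sup>2)" for k
    unfolding W_def[abs_def] by (intro sums_mult2 V_sums level)
  then have left: "(\<lambda>j. \<Sum>k<K. W k j) sums (\<Sum>k<K. V (level k) * (1 / q ^ k)\<^sup>2)"
    by (intro sums_sum)
  have right: "(\<lambda>j. 1 / (l (j + 2) * A (j + 1))\<^sup>2 / (1 - q\<^sup>2)) sums
      ((\<Sum>j. 1 / (l (j + 2) * A (j + 1))\<^sup>2) / (1 - q\<^sup>2))"
    using summable_squares by (intro sums_divide summable_sums)
  have le: "(\<Sum>k<K. W k j) \<le> 1 / (l (j + 2) * A (j + 1))\<^sup>2 / (1 - q\<^sup>2)" for j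
  proof -
    have "(\<Sum>k<K. W k j) = (1 / l (j + 2))\<^sup>2 * (\<Sum>k<K. if A (j + 1) \<le> q ^ k then (1 / q ^ k)\<^sup>2 else 0)"
      unfolding sum_distrib_left W_def by (intro sum.cong) (auto simp: level_le_iff)
    also have "\<dots> \<le> (1 / l (j + 2))\<^sup>2 * ((1 / A (j + 1))\<^sup>2 / (1 - q\<^sup>2))"
      using sum_inverse_powers_le[OF q A_pos[of "j + 1"]] by (intro mult_left_mono) auto
    also have "\<dots> = 1 / (l (j + 2) * A (j + 1))\<^sup>2 / (1 - q\<^sup>2)"
      by (simp add: power_one_over power_mult_distrib)
    finally show ?thesis .
  qed
  show "(\<Sum>k<K. V (level k) * (1 / q ^ k)\<^sup>2) \<le> (\<Sum>j. 1 / (l (j + 2) * A (j + 1))\<^sup>2) / (1 - q\<^sup>2)"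
    by (rule sums_le[OF le left right])
qed

text \<open>The squares have summable expectations, so by Tonelli their series converges almost
  surely and its terms tend to 0. This replaces a Borel-Cantelli argument.\<close>

lemma T_level_converges: "AE \<omega> in M. (\<lambda>k. (T (level k) \<omega> - A (level k)) / q ^ k) \<longlonglongrightarrow> 0"
proof -
  let ?D = "\<lambda>k \<omega>. ((T (level k) \<omega> - A (level k)) / q ^ k)\<^sup>2"
  have [measurable]: "T (level k) \<in> borel_measurable M" for k
    by (intro T_measurable level)
  have D_int: "(\<integral>\<^sup>+\<omega>. ennreal (?D k \<omega>) \<partial>M) \<le> ennreal (V (level k) * (1 / q ^ k)\<^sup>2)" for k
  proof -
    have "(\<integral>\<^sup>+\<omega>. ennreal (?D k \<omega>) \<partial>M) =
        (\<integral>\<^sup>+\<omega>. ennreal ((1 / q ^ k)\<^sup>2) * ennreal ((T (level k) \<omega> - A (level k))\<^sup>2) \<partial>M)"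
      by (simp add: ennreal_mult[symmetric] power_divide)
    also have "\<dots> = ennreal ((1 / q ^ k)\<^sup>2) * (\<integral>\<^sup>+\<omega>. ennreal ((T (level k) \<omega> - A (level k))\<^sup>2) \<partial>M)"
      by (rule nn_integral_cmult) measurable
    also have "\<dots> \<le> ennreal ((1 / q ^ k)\<^sup>2) * ennreal (V (level k))"
      by (intro mult_left_mono T_variance_le level) simp
    also have "\<dots> = ennreal (V (level k) * (1 / q ^ k)\<^sup>2)"
      using V_pos[OF level(1), of k] by (simp add: ennreal_mult[symmetric] mult.commute)
    finally show ?thesis .
  qed
  have "(\<integral>\<^sup>+\<omega>. (\<Sum>k. ennreal (?D k \<omega>)) \<partial>M) = (\<Sum>k. \<integral>\<^sup>+\<omega>. ennreal (?D k \<omega>) \<partial>M)"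
    by (rule nn_integral_suminf) measurable
  also have "\<dots> \<le> (\<Sum>k. ennreal (V (level k) * (1 / q ^ k)\<^sup>2))"
    by (intro suminf_le D_int) auto
  also have "\<dots> = ennreal (\<Sum>k. V (level k) * (1 / q ^ k)\<^sup>2)"
    using level_variance_summable V_pos[OF level(1)] by (intro suminf_ennreal2) (auto simp: less_imp_le)
  also have "\<dots> < \<infinity>" by simp
  finally have "AE \<omega> in M. (\<Sum>k. ennreal (?D k \<omega>)) \<noteq> \<infinity>"
    by (intro nn_integral_noteq_infinite) auto
  then show ?thesis
  proof eventually_elim
    case (elim \<omega>)
    then have "summable (\<lambda>k. ?D k \<omega>)"
      by (intro summable_suminf_not_top) auto
    then have "(\<lambda>k. sqrt (?D k \<omega>)) \<longlonglongrightarrow> sqrt 0"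
      by (intro tendsto_real_sqrt summable_LIMSEQ_zero)
    then show ?case
      by (simp only: real_sqrt_abs real_sqrt_zero tendsto_rabs_zero_iff)
  qed
qed

text \<open>Monotonicity interpolates between consecutive levels at the cost of one factor
  \<open>q\<close>. Both bounds tend to 1 as \<open>q\<close> does.\<close>

lemma T_ratio_bounds:
  "AE \<omega> in M. eventually (\<lambda>n. (2 * q - 1) * q \<le> T n \<omega> / A n \<and> T n \<omega> / A n \<le> (2 - q) / q) sequentially"
  using T_level_converges T_antimono
proof eventually_elim
  case (elim \<omega>)
  have "eventually (\<lambda>k. \<bar>(T (level k) \<omega> - A (level k)) / q ^ k\<bar> < 1 - q) sequentially"
    using tendsto_rabs_zero[OF elim(1)] q by (intro order_tendstoD) auto
  \<comment> \<open>\<open>A\<close> lies between \<open>q * q ^ k\<close> and \<open>q ^ k\<close>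
    and the deviation is below \<open>(1 - q) * q ^ k\<close>; so the constants are q - (1 - q) and
    1 + (1 - q).\<close>
  with A_level_ge have "eventually (\<lambda>k. (2 * q - 1) * q ^ k \<le> T (level k) \<omega> \<and> T (level k) \<omega> \<le> (2 - q) * q ^ k) sequentially"
  proof eventually_elim
    case (elim k)
    have "q ^ k > 0" using q by simp
    then have "\<bar>T (level k) \<omega> - A (level k)\<bar> < (1 - q) * q ^ k"
      using elim(2) by (simp add: abs_divide pos_divide_less_eq)
    moreover have "q * q ^ k \<le> A (level k)" "A (level k) \<le> q ^ k"
      using elim(1) level(2) by auto
    ultimately show ?case
      by (auto simp: algebra_simps abs_less_iff)
  qed
  then obtain K where K: "\<And>k. k \<ge> K \<Longrightarrow> (2 * q - 1) * q ^ k \<le> T (level k) \<omega>"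
    "\<And>k. k \<ge> K \<Longrightarrow> T (level k) \<omega> \<le> (2 - q) * q ^ k"
    by (auto simp: eventually_sequentially)
  have "eventually (\<lambda>n. A n < q ^ K) sequentially"
    using A_tendsto_0 q by (intro order_tendstoD) auto
  then show ?case
    using eventually_ge_at_top[of 1]
  proof eventually_elim
    case (elim n)
    have pos: "A n > 0" using elim A_pos by simp
    have "(\<lambda>k. q ^ k) \<longlonglongrightarrow> 0"
      using q by (intro LIMSEQ_power_zero) simp
    then have "eventually (\<lambda>k. q ^ k < A n) sequentially"
      using pos by (intro order_tendstoD) auto
    then have ex: "\<exists>k. q ^ k < A n"
      by (rule eventually_happens'[OF sequentially_bot])
    \<comment> \<open>The predecessor \<open>k\<close> of \<open>j\<close> satisfies
      \<open>q ^ Suc k < A n \<le> q ^ k\<close>, which places \<open>n\<close> between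
      \<open>level k\<close> and \<open>level (Suc k)\<close>.\<close>
    define j where "j = (LEAST k. q ^ k < A n)"
    have j: "q ^ j < A n"
      unfolding j_def by (rule LeastI_ex[OF ex])
    have "K < j"
    proof (rule ccontr)
      assume "\<not> K < j"
      then have "q ^ K \<le> q ^ j"
        using q by (intro power_decreasing) auto
      with j elim show False by simp
    qed
    then obtain k where k: "j = Suc k" "k \<ge> K"
      by (cases j) auto
    have "\<not> q ^ k < A n"
      using k not_less_Least[of k "\<lambda>k. q ^ k < A n"] by (simp add: j_def)
    then have lev: "level k \<le> n" "n \<le> level (Suc k)"
      using level_le_iff[of n k] level_le_iff[of n "Suc k"] elim j k by auto
    have "T n \<omega> \<le> T (level k) \<omega>" "T (level (Suc k)) \<omega> \<le> T n \<omega>"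
      using \<open>\<forall>m n. 1 \<le> m \<longrightarrow> m \<le> n \<longrightarrow> T n \<omega> \<le> T m \<omega>\<close> lev level(1) elim(2) by auto
    with K[of k] K[of "Suc k"] k have T_le: "T n \<omega> \<le> (2 - q) * q ^ k" and T_ge: "(2 * q - 1) * q ^ Suc k \<le> T n \<omega>"
      by auto
    have "(2 - q) * q ^ k \<le> (2 - q) / q * A n"
    proof -
      have "q ^ k \<le> A n / q"
        using q j k by (simp add: pos_le_divide_eq mult.commute)
      then have "(2 - q) * q ^ k \<le> (2 - q) * (A n / q)"
        using q by (intro mult_left_mono) auto
      then show ?thesis by simp
    qed
    with T_le have "T n \<omega> \<le> (2 - q) / q * A n" by simp
    moreover have "(2 * q - 1) * q * A n \<le> T n \<omega>"
    proof -
      \<comment> \<open>\<open>q_half\<close> makes \<open>2 * q - 1\<close> nonnegative, so the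
        upper bound \<open>q ^ k\<close> for \<open>A n\<close> can be inserted.\<close>
      have "(2 * q - 1) * q * A n \<le> (2 * q - 1) * q * q ^ k"
        using \<open>\<not> q ^ k < A n\<close> q q_half by (intro mult_left_mono) auto
      with T_ge show ?thesis by (simp add: mult.assoc)
    qed
    ultimately show ?case
      using pos by (simp add: pos_divide_le_eq pos_le_divide_eq)
  qed
qed

end

theorem strong_law:
  assumes "summable (\<lambda>i. 1 / (l (i + 2) * A (i + 1))\<^sup>2)"
  shows "AE \<omega> in M. (\<lambda>n. T n \<omega> / A n) \<longlonglongrightarrow> 1"
proof -
  \<comment> \<open>Countably many values of \<open>q\<close> tending to 1 share one null set;
    \<open>p 0\<close> is 1 / 2, the least value allowed.\<close>
  define p where "p m = 1 - 1 / real (m + 2)" for m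
  have p: "1 / 2 \<le> p m" "p m < 1" for m
    by (auto simp: p_def field_simps)
  have "AE \<omega> in M. \<forall>m. eventually (\<lambda>n. (2 * p m - 1) * p m \<le> T n \<omega> / A n \<and> T n \<omega> / A n \<le> (2 - p m) / p m) sequentially"
    using T_ratio_bounds[OF p assms] by (simp add: AE_all_countable)
  then show ?thesis
  proof eventually_elim
    case (elim \<omega>)
    have "(\<lambda>m. 1 / real (m + 2)) \<longlonglongrightarrow> 0"
      using LIMSEQ_ignore_initial_segment[OF lim_1_over_n[where 'a = real], of 2] .
    then have p_lim: "p \<longlonglongrightarrow> 1"
      unfolding p_def[abs_def] using tendsto_diff[OF tendsto_const[of 1]] by fastforce
    have lim_lower: "(\<lambda>m. (2 * p m - 1) * p m) \<longlonglongrightarrow> (2 * 1 - 1) * 1"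
      and lim_upper: "(\<lambda>m. (2 - p m) / p m) \<longlonglongrightarrow> (2 - 1) / 1"
      by (intro tendsto_intros p_lim; simp)+
    show ?case
    proof (rule order_tendstoI)
      fix a :: real assume "a < 1"
      then have "eventually (\<lambda>m. a < (2 * p m - 1) * p m) sequentially"
        using lim_lower by (intro order_tendstoD) auto
      then obtain m where "a < (2 * p m - 1) * p m"
        by (auto dest: eventually_happens'[OF sequentially_bot])
      with elim[rule_format, of m] show "eventually (\<lambda>n. a < T n \<omega> / A n) sequentially"
        by (auto elim: eventually_mono)
    next
      fix a :: real assume "1 < a"
      then have "eventually (\<lambda>m. (2 - p m) / p m < a) sequentially"
        using lim_upper by (intro order_tendstoD) auto
      then obtain m where "(2 - p m) / p m < a"
        by (auto dest: eventually_happens'[OF sequentially_bot])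
      with elim[rule_format, of m] show "eventually (\<lambda>n. T n \<omega> / A n < a) sequentially"
        by (auto elim: eventually_mono)
    qed
  qed
qed

end

text \<open>The first conjunct certifies that \<open>hitting_time\<close> is almost surely a
  convergent series with the asserted mean. The limit law enters as existence together with
  convergence to every law having the transform.\<close>

theorem theorem1:
  fixes M :: "'a measure"
    and l :: "nat \<Rightarrow> real"
    and X :: "nat \<Rightarrow> 'a \<Rightarrow> real"
  assumes "prob_space M"
    and "\<And>n. n \<ge> 2 \<Longrightarrow> l n > 0"
    and "summable (\<lambda>n. 1 / l (n + 2))"
    and "prob_space.indep_vars M (\<lambda>_. borel) X {2..}"
    and "\<And>i. i \<ge> 2 \<Longrightarrow> distributed M lborel (X i) (exponential_density (l i))"
  shows
    "(\<forall>n\<ge>1. (AE \<omega> in M. summable (\<lambda>i. X (n + 1 + i) \<omega>)) \<and>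
        integrable M (hitting_time X n) \<and>
        (LINT \<omega>|M. hitting_time X n \<omega>) = A_tail l n) \<and>
     (\<forall>\<alpha>. 0 \<le> \<alpha> \<and> \<alpha> < 1 \<and> (\<lambda>n. l n / l (n + 1)) \<longlonglongrightarrow> \<alpha> \<longrightarrow>
        (\<exists>\<mu>. is_limit_law \<alpha> \<mu>) \<and>
        (\<forall>\<mu>. is_limit_law \<alpha> \<mu> \<longrightarrow>
           (\<forall>x\<ge>0. (\<lambda>n. \<P>(\<omega> in M. hitting_time X n \<omega> / A_tail l n \<le> x)) \<longlonglongrightarrow> cdf \<mu> x))) \<and>
     ((\<lambda>n. 1 / l n) \<in> o(A_tail l) \<longrightarrow>
        converges_in_probability M (\<lambda>n \<omega>. hitting_time X n \<omega> / A_tail l n) 1) \<and>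
     (summable (\<lambda>i. 1 / (l (i + 2) * A_tail l (i + 1)) ^ 2) \<longrightarrow>
        (AE \<omega> in M. (\<lambda>n. hitting_time X n \<omega> / A_tail l n) \<longlonglongrightarrow> 1)) \<and>
     ((\<lambda>n. 1 / l n) \<in> o(A_tail l) \<and> C_tail l \<in> o(B_tail l) \<longrightarrow>
        (\<forall>x. (\<lambda>n. \<P>(\<omega> in M. (hitting_time X n \<omega> - A_tail l n) / B_tail l n \<le> x))
           \<longlonglongrightarrow> cdf std_normal_distribution x))"
proof -
  interpret death_from_infinity M l X
    using assms by (intro death_from_infinity.intro death_from_infinity_axioms.intro) auto
  show ?thesis
  proof (intro conjI allI impI)
    fix \<alpha> :: real
    assume \<alpha>: "0 \<le> \<alpha> \<and> \<alpha> < 1 \<and> (\<lambda>n. l n / l (n + 1)) \<longlonglongrightarrow> \<alpha>"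
    then show "\<exists>\<mu>. is_limit_law \<alpha> \<mu>"
      using limit_law_exists[of \<alpha>] by metis
    fix \<mu> x
    assume "is_limit_law \<alpha> \<mu>"
    with \<alpha> show "(\<lambda>n. \<P>(\<omega> in M. hitting_time X n \<omega> / A_tail l n \<le> x)) \<longlonglongrightarrow> cdf \<mu> x"
      by (intro limit_law_convergence) simp_all
  qed (simp_all only: X_summable T_integrable T_expectation weak_law strong_law central_limit)
qed

end
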